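(* For the input instance set $\mathcal{I}$ consisting of all instances with finitely many jobs in which every job satisfies $d_i\geq r_i+p_i$: (1) the competitive ratio $3-2\sqrt{2}$ is achievable by the online algorithm DSC (with threshold parameter $\beta=1+\sqrt{2}$); (2) $3-2\sqrt{2}$ upper bounds the competitive ratio achievable by any online scheduling algorithm.
   Context: Online preemptive scheduling on a single processor. Each job $T=(r,p,d,v)$ has release time $r$, processing time $p$, firm deadline $d$, and value $v=p$ (proportional value model). Preemption is free. An online scheduler learns a job's parameters only at its release time and must immediately (commitment) accept or decline it. An accepted job completed by its deadline earns its value; an accepted job not completed by its deadline earns no value and incurs a penalty equal to its unfinished workload (shortage). Declined jobs give neither reward nor penalty. The profit is the total value of completed jobs minus all penalties. An online algorithm is $\alpha$-competitive on $\mathcal{I}$ if $\min_{I\in\mathcal{I}} S_{\text{online}}(I)/S^\ast_{\text{offline}}(I)\geq\alpha$, where $S^\ast_{\text{offline}}(I)$ is the value of the optimal clairvoyant offline scheduler. The algorithm DSC maintains a tentative schedule; when a job arrives, if it can be appended at the end of the tentative schedule and still meet its deadline, it is accepted and appended. Otherwise it computes $\text{Profit}_{accept}$ (value of the new job minus the penalty attributable to accepting it, i.e., due to jobs whose received processing is affected) and $\text{Profit}_{decline}$ (value of the affected jobs anticipated to complete under the current tentative schedule minus their attributable penalty), where the affected jobs are those whose processing is changed by scheduling the new job in $[d-p,d]$ and postponing the previous schedule after $d-p$ to start at $d$ or the end of the current schedule (whichever is later), with portions of moved jobs past their deadlines removed. If $\text{Profit}_{accept}>(1+\beta)\text{Profit}_{decline}$,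 the job is accepted and scheduled this way; otherwise it is declined.
   Formalization: DSC's rule is corrected to Profit_accept > β·Profit_decline, β=1+√2 (factor 1+β fails on tight-job chains); Profit_decline counts only the value of affected jobs due to complete; if the schedule ends after d, only work in [d−p,d] is postponed, the part after d stays. *)

theory Defs
  imports "HOL-Analysis.Analysis"
begin

section \<open>Jobs and instances\<close>

record job =
  release :: real
  proc :: real
  deadline :: real

text \<open>Proportional value model: the value of a job is its processing time.\<close>
definition job_value :: "job \<Rightarrow> real" where
  "job_value T = proc T"

text \<open>
  An instance is a finite list of jobs in order of arrival, and a job is identified by its
  position in the list.  Jobs with equal release times arrive in list order.
\<close>
definition instances :: "job list set" where
  "instances = {I. sorted (map release I) \<and>
     (\<forall>T \<in> set I. 0 < proc T \<and> release T + proc T \<le> deadline T)}"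


section \<open>Outcomes and profit\<close>

text \<open>
  An outcome consists of the set of accepted jobs and a preemptive single-processor schedule:
  \<open>\<sigma> t = Some i\<close> if job \<open>i\<close> is processed at time \<open>t\<close>, and \<open>\<sigma> t = None\<close> if the processor is idle.
\<close>
type_synonym outcome = "nat set \<times> (real \<Rightarrow> nat option)"

definition valid_outcome :: "job list \<Rightarrow> outcome \<Rightarrow> bool" where
  "valid_outcome I = (\<lambda>(A, \<sigma>).
     A \<subseteq> {..<length I} \<and>
     (\<forall>i. {t. \<sigma> t = Some i} \<in> sets lebesgue) \<and>
     (\<forall>t i. \<sigma> t = Some i \<longrightarrow> i \<in> A \<and> release (I ! i) \<le> t \<and> t \<le> deadline (I ! i)))"

text \<open>In a valid outcome all processing of a job takes place between its release and its deadline.\<close>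
definition received :: "(real \<Rightarrow> nat option) \<Rightarrow> nat \<Rightarrow> real" where
  "received \<sigma> i = measure lebesgue {t. \<sigma> t = Some i}"

definition profit :: "job list \<Rightarrow> outcome \<Rightarrow> real" where
  "profit I = (\<lambda>(A, \<sigma>). \<Sum>i\<in>A.
     if proc (I ! i) \<le> received \<sigma> i then job_value (I ! i)
     else - (proc (I ! i) - received \<sigma> i))"

definition offline_opt :: "job list \<Rightarrow> real" where
  "offline_opt I = (SUP x \<in> {x. valid_outcome I x}. profit I x)"


section \<open>Online schedulers and competitiveness\<close>

type_synonym scheduler = "job list \<Rightarrow> outcome"

definition released_by :: "real \<Rightarrow> job list \<Rightarrow> job list" where
  "released_by t I = filter (\<lambda>T. release T \<le> t) I"

text \<open>
  Everything a scheduler does up to time \<open>t\<close>, including the irrevocable admission decision for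
  each job released by then, depends only on the jobs released by time \<open>t\<close>.  As instances are
  sorted, these jobs form a prefix of the instance, so that positions in both instances agree.
\<close>
definition online_scheduler :: "scheduler \<Rightarrow> bool" where
  "online_scheduler S \<longleftrightarrow>
     (\<forall>I \<in> instances. valid_outcome I (S I)) \<and>
     (\<forall>I \<in> instances. \<forall>J \<in> instances. \<forall>t. released_by t I = released_by t J \<longrightarrow>
        (\<forall>i < length (released_by t I). i \<in> fst (S I) \<longleftrightarrow> i \<in> fst (S J)) \<and>
        (\<forall>s \<le> t. snd (S I) s = snd (S J) s))"

text \<open>The only instance excluded by the guard is the empty one, for which the ratio is undefined.\<close>
definition competitive :: "real \<Rightarrow> scheduler \<Rightarrow> job list set \<Rightarrow> bool" where
  "competitive \<alpha> S \<I> \<longleftrightarrow>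
     (\<forall>I \<in> \<I>. 0 < offline_opt I \<longrightarrow> \<alpha> \<le> profit I (S I) / offline_opt I)"


section \<open>The algorithm DSC\<close>

text \<open>
  A tentative schedule is a chronological list of pieces: \<open>(i, a, b)\<close> means that job \<open>i\<close> is
  processed during \<open>[a, b)\<close>.  Pieces that already lie in the past are kept, so that the final
  plan is the schedule that is actually carried out.
\<close>
type_synonym plan = "(nat \<times> real \<times> real) list"

definition plan_schedule :: "plan \<Rightarrow> real \<Rightarrow> nat option" where
  "plan_schedule P t = map_option fst (find (\<lambda>(i, a, b). a \<le> t \<and> t < b) P)"

text \<open>The end of the plan as seen at time \<open>t\<close>: it is \<open>t\<close> itself if no planned work remains.\<close>
definition plan_end :: "real \<Rightarrow> plan \<Rightarrow> real" where
  "plan_end t P = (if P = [] then t else max t (snd (snd (last P))))"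

definition plan_before :: "real \<Rightarrow> plan \<Rightarrow> plan" where
  "plan_before c P = [(i, a, min b c). (i, a, b) \<leftarrow> P, a < c]"

definition plan_after :: "real \<Rightarrow> plan \<Rightarrow> plan" where
  "plan_after c P = [(i, max a c, b). (i, a, b) \<leftarrow> P, c < b]"

text \<open>
  Lay out the given pieces from time \<open>s\<close> on, in their old order and without idle time, removing
  every portion that would lie past the deadline of its job.
\<close>
fun postpone :: "job list \<Rightarrow> real \<Rightarrow> plan \<Rightarrow> plan" where
  "postpone I s [] = []"
| "postpone I s ((i, a, b) # P) =
     (let e = min (s + (b - a)) (deadline (I ! i)) in
      if s < e then (i, s, e) # postpone I e P else postpone I s P)"

text \<open>
  Job \<open>n\<close> takes the interval \<open>[d - p, d]\<close>.  The work planned there is postponed to start at \<open>d\<close> or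
  at the end of the plan, whichever is later.  If the plan extends beyond \<open>d\<close>, its part after \<open>d\<close>
  therefore stays in place.
\<close>
definition insert_job :: "job list \<Rightarrow> nat \<Rightarrow> plan \<Rightarrow> plan" where
  "insert_job I n P =
     (let d = deadline (I ! n); c = d - proc (I ! n); e = plan_end (release (I ! n)) P in
      plan_before c P @ [(n, c, d)] @ plan_after d P @
      postpone I (max d e) (plan_after c (plan_before d P)))"

definition planned_work :: "plan \<Rightarrow> nat \<Rightarrow> real" where
  "planned_work P i = (\<Sum>(j, a, b) \<leftarrow> P. if j = i then b - a else 0)"

definition planned_shortage :: "job list \<Rightarrow> plan \<Rightarrow> nat \<Rightarrow> real" where
  "planned_shortage I P i = proc (I ! i) - planned_work P i"

text \<open>The accepted jobs that receive a different amount of processing under \<open>Q\<close> than under \<open>P\<close>.\<close>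
definition affected :: "nat set \<Rightarrow> plan \<Rightarrow> plan \<Rightarrow> nat set" where
  "affected A P Q = {i \<in> A. planned_work Q i \<noteq> planned_work P i}"

text \<open>
  Only the shortage added by passing from \<open>P\<close> to \<open>Q\<close> is attributed to accepting job \<open>n\<close>; the
  shortage that an affected job already has under \<open>P\<close> is not caused by this decision.
\<close>
definition profit_accept :: "job list \<Rightarrow> nat set \<Rightarrow> plan \<Rightarrow> plan \<Rightarrow> nat \<Rightarrow> real" where
  "profit_accept I A P Q n =
     job_value (I ! n) -
     (\<Sum>i \<in> affected A P Q. planned_shortage I Q i - planned_shortage I P i)"

text \<open>The penalty of the jobs counted here is the one they incur under \<open>P\<close>.\<close>
definition profit_decline :: "job list \<Rightarrow> nat set \<Rightarrow> plan \<Rightarrow> plan \<Rightarrow> real" where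
  "profit_decline I A P Q =
     (\<Sum>i \<in> {i \<in> affected A P Q. proc (I ! i) \<le> planned_work P i}.
        job_value (I ! i) - planned_shortage I P i)"

text \<open>
  The threshold parameter \<open>\<beta>\<close> is the factor that multiplies \<open>profit_decline\<close>.  If the factor is
  written \<open>1 + \<gamma>\<close> instead, then \<open>\<beta> = 1 + sqrt 2\<close> here corresponds to \<open>\<gamma> = sqrt 2\<close>.  (With the
  factor \<open>2 + sqrt 2\<close> the ratio \<open>3 - 2 * sqrt 2\<close> is not attained: consider jobs without laxity
  that arrive in immediate succession, each just large enough to be accepted in place of the
  previous one, followed by one that is just too small.)
\<close>
definition dsc_step :: "real \<Rightarrow> job list \<Rightarrow> nat \<Rightarrow> nat set \<times> plan \<Rightarrow> nat set \<times> plan" where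
  "dsc_step \<beta> I n = (\<lambda>(A, P).
     let T = I ! n; e = plan_end (release T) P; Q = insert_job I n P in
     if e + proc T \<le> deadline T then (insert n A, P @ [(n, e, e + proc T)])
     else if profit_accept I A P Q n > \<beta> * profit_decline I A P Q then (insert n A, Q)
     else (A, P))"

definition dsc :: "real \<Rightarrow> scheduler" where
  "dsc \<beta> I = (let (A, P) = fold (dsc_step \<beta> I) [0..<length I] ({}, []) in (A, plan_schedule P))"

end

(*
  Upper bound: jobs without laxity, of geometrically growing size, arrive in quick succession, so that
  at most one of them can be completed.  To stay competitive against the newest job, a scheduler must
  accept jobs of sizes x_0, x_1, ... with kappa * x_(m+1) <= x_m - (x_0 + ... + x_(m-1)), which has no
  infinite positive solution if kappa > 3 - 2 sqrt 2.

  Lower bound: let beta = 1 + sqrt 2, so beta^2 = 2 beta + 1.  Inserting a job moves the end of the plan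
  by exactly Profit_accept, and every job whose processing changes has its deadline before the new end.
  If C is the value of the completed jobs, B the total length of the other accepted ones and H their
  shortage, then (beta - 1) B + H <= C throughout.  A declined job fits into a window that exceeds the
  plan by at most beta times the value it would have spoiled; charging this excess to the endangered
  completed jobs bounds the optimum by (beta + 1) C + B - H <= beta^2 (C - H).
*)
theory Submission
  imports Defs
begin

section \<open>Plans\<close>

text \<open>Origin of the constants: as \<open>H \<le> B\<close>, the two estimates are worst at
  \<open>H = B = C / \<beta>\<close> and give the factor \<beta> (\<beta> + 1) / (\<beta> - 1). It
  is minimal where \<beta>^2 = 2 \<beta> + 1, and its value there is \<beta>^2 = 3 + 2 sqrt 2, the
  reciprocal of 3 - 2 sqrt 2. The obstacle in the charging is that one completed job may be
  endangered by many declined jobs, yet can pay \<beta> times its value only once. Therefore the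
  uncovered idle time of the current busy period is not merely bounded in measure but confined to an
  interval starting at the end of the plan, where charges of several declined jobs overlap instead
  of adding up. An acceptance moves this end by more than \<beta> times the spoiled value, so
  spoiled jobs can stop paying. Once the processor runs out of work, the account of the busy period
  is closed and only its measure matters. On the adversary's side, sizes grow by a factor close to
  1, so that the inequality forced just before the next acceptance already speaks about the next
  accepted size.\<close>

definition total_work :: "plan \<Rightarrow> real" where
  "total_work P = (\<Sum>(i, a, b) \<leftarrow> P. b - a)"

definition busy :: "plan \<Rightarrow> real set" where
  "busy P = (\<Union>(i, a, b) \<in> set P. {a..<b})"

definition chronological :: "plan \<Rightarrow> bool" where
  "chronological P \<longleftrightarrow> (\<forall>(i, a, b) \<in> set P. a < b) \<and> sorted_wrt (\<lambda>(i, a, b) (j, a', b'). b \<le> a') P"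

lemma busy_simps [simp]:
  "busy [] = {}" "busy ((i, a, b) # P) = {a..<b} \<union> busy P" "busy (P @ Q) = busy P \<union> busy Q"
  by (auto simp: busy_def)

lemma total_work_simps [simp]:
  "total_work [] = 0" "total_work ((i, a, b) # P) = b - a + total_work P"
  "total_work (P @ Q) = total_work P + total_work Q"
  by (auto simp: total_work_def)

lemma planned_work_simps [simp]:
  "planned_work [] i = 0"
  "planned_work ((j, a, b) # P) i = (if j = i then b - a else 0) + planned_work P i"
  "planned_work (P @ Q) i = planned_work P i + planned_work Q i"
  by (auto simp: planned_work_def)

lemma chronological_simps [simp]:
  "chronological []"
  "chronological ((i, a, b) # P) \<longleftrightarrow> a < b \<and> (\<forall>(j, a', b') \<in> set P. b \<le> a') \<and> chronological P"
  "chronological (P @ Q) \<longleftrightarrow> chronological P \<and> chronological Q \<and>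
     (\<forall>(i, a, b) \<in> set P. \<forall>(j, a', b') \<in> set Q. b \<le> a')"
  by (auto simp: chronological_def sorted_wrt_append split: prod.splits)

lemma chronological_less: "chronological P \<Longrightarrow> (i, a, b) \<in> set P \<Longrightarrow> a < b"
  by (auto simp: chronological_def)

lemma chronological_filter: "chronological P \<Longrightarrow> chronological (filter f P)"
  by (auto simp: chronological_def sorted_wrt_filter)

lemma busyE:
  assumes "t \<in> busy P"
  obtains i a b where "(i, a, b) \<in> set P" "a \<le> t" "t < b"
  using assms by (auto simp: busy_def)

lemma busyI: "(i, a, b) \<in> set P \<Longrightarrow> a \<le> t \<Longrightarrow> t < b \<Longrightarrow> t \<in> busy P"
  by (auto simp: busy_def intro!: bexI[of _ "(i, a, b)"])

lemma lmeasurable_atLeastLessThan [simp]: "{a..<b::real} \<in> lmeasurable"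
  by (rule bounded_set_imp_lmeasurable) auto

lemma lmeasurable_busy [simp]: "busy P \<in> lmeasurable"
  by (induction P) (auto intro!: fmeasurable.Un)

lemma measure_busy: "chronological P \<Longrightarrow> measure lebesgue (busy P) = total_work P"
proof (induction P)
  case (Cons x P)
  obtain i a b where x: "x = (i, a, b)" by (cases x)
  have "{a..<b} \<inter> busy P = {}"
    using Cons.prems x by (fastforce elim!: busyE)
  then have "measure lebesgue ({a..<b} \<union> busy P) = measure lebesgue {a..<b} + measure lebesgue (busy P)"
    by (intro measure_Un3[THEN trans]) auto
  then show ?case
    using Cons x by auto
qed auto

lemma planned_work_filter: "planned_work P i = total_work (filter (\<lambda>q. fst q = i) P)"
  by (induction P) auto

text \<open>The pieces of a chronological plan are pairwise disjoint, so the first piece that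
  \<open>find\<close> meets at time \<open>t\<close> is the only one there.\<close>

lemma plan_schedule_iff:
  assumes "chronological P"
  shows "plan_schedule P t = Some i \<longleftrightarrow> t \<in> busy (filter (\<lambda>q. fst q = i) P)"
  using assms
proof (induction P)
  case (Cons x P)
  obtain j a b where x: "x = (j, a, b)" by (cases x)
  have "t \<notin> busy P" if "t < b"
    using Cons.prems x that by (fastforce elim!: busyE)
  moreover have "busy (filter (\<lambda>q. fst q = i) P) \<subseteq> busy P"
    by (auto simp: busy_def)
  ultimately show ?case
    using Cons x by (auto simp: plan_schedule_def)
qed (auto simp: plan_schedule_def)

lemma received_plan_schedule:
  assumes "chronological P"
  shows "received (plan_schedule P) i = planned_work P i"
proof -
  have "{t. plan_schedule P t = Some i} = busy (filter (\<lambda>q. fst q = i) P)"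
    using assms by (auto simp: plan_schedule_iff)
  then show ?thesis
    using assms by (simp add: received_def measure_busy chronological_filter planned_work_filter)
qed

section \<open>Cutting plans at a time and laying out postponed pieces\<close>

lemma plan_before_simps [simp]:
  "plan_before c [] = []"
  "plan_before c ((i, a, b) # P) = (if a < c then [(i, a, min b c)] else []) @ plan_before c P"
  by (auto simp: plan_before_def)

lemma plan_after_simps [simp]:
  "plan_after c [] = []"
  "plan_after c ((i, a, b) # P) = (if c < b then [(i, max a c, b)] else []) @ plan_after c P"
  by (auto simp: plan_after_def)

lemma set_plan_before: "set (plan_before c P) = {(i, a, min b c) | i a b. (i, a, b) \<in> set P \<and> a < c}"
  by (induction P) auto

lemma set_plan_after: "set (plan_after c P) = {(i, max a c, b) | i a b. (i, a, b) \<in> set P \<and> c < b}"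
  by (induction P) auto

lemma chronological_plan_before: "chronological P \<Longrightarrow> chronological (plan_before c P)"
proof (induction P)
  case (Cons x P)
  obtain i a b where x: "x = (i, a, b)" by (cases x)
  have "min b c \<le> a'" if "(j, a', b') \<in> set (plan_before c P)" for j a' b'
    using that Cons.prems x unfolding set_plan_before by fastforce
  then show ?case
    using Cons x by auto
qed auto

lemma chronological_plan_after: "chronological P \<Longrightarrow> chronological (plan_after c P)"
proof (induction P)
  case (Cons x P)
  obtain i a b where x: "x = (i, a, b)" by (cases x)
  have "b \<le> a'" if "(j, a', b') \<in> set (plan_after c P)" for j a' b'
    using that Cons.prems x unfolding set_plan_after by fastforce
  then show ?case
    using Cons x by auto
qed auto

text \<open>The job predicate \<open>f\<close> is left general for two uses: constantly true it
  yields the busy set, and as a test for a single job it yields the times at which that job is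
  processed.\<close>

lemma busy_filter_plan_before:
  "busy (filter (\<lambda>q. f (fst q)) (plan_before c P)) = busy (filter (\<lambda>q. f (fst q)) P) \<inter> {..<c}"
proof (induction P)
  case (Cons x P)
  obtain i a b where x: "x = (i, a, b)" by (cases x)
  have "{a..<min b c} = {a..<b} \<inter> {..<c}" "\<not> a < c \<Longrightarrow> {a..<b} \<inter> {..<c} = {}" by auto
  then show ?case
    using Cons x by (simp add: Int_Un_distrib2)
qed auto

lemma busy_plan_before: "busy (plan_before c P) = busy P \<inter> {..<c}"
  using busy_filter_plan_before[of "\<lambda>_. True"] by simp

lemma busy_filter_plan_after:
  "busy (filter (\<lambda>q. f (fst q)) (plan_after c P)) = busy (filter (\<lambda>q. f (fst q)) P) \<inter> {c..}"
proof (induction P)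
  case (Cons x P)
  obtain i a b where x: "x = (i, a, b)" by (cases x)
  have "{max a c..<b} = {a..<b} \<inter> {c..}" "\<not> c < b \<Longrightarrow> {a..<b} \<inter> {c..} = {}" by auto
  then show ?case
    using Cons x by (simp add: Int_Un_distrib2)
qed auto

lemma busy_plan_after: "busy (plan_after c P) = busy P \<inter> {c..}"
  using busy_filter_plan_after[of "\<lambda>_. True"] by simp

lemma planned_work_split:
  assumes "chronological P"
  shows "planned_work (plan_before c P) i + planned_work (plan_after c P) i = planned_work P i"
  using assms by (induction P) auto

lemma planned_work_eq_0: "i \<notin> fst ` set P \<Longrightarrow> planned_work P i = 0"
  by (induction P) auto

lemma planned_work_nonneg: "chronological P \<Longrightarrow> 0 \<le> planned_work P i"
  by (induction P) auto

lemma sum_planned_work: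
  assumes "finite A" "fst ` set P \<subseteq> A"
  shows "(\<Sum>i\<in>A. planned_work P i) = total_work P"
  using assms by (induction P) (auto simp: sum.distrib)

lemma postpone_starts: "(i, a, b) \<in> set (postpone I s P) \<Longrightarrow> s \<le> a"
  by (induction I s P rule: postpone.induct) (fastforce simp: Let_def split: if_splits)+

lemma chronological_postpone: "chronological (postpone I s P)"
  by (induction I s P rule: postpone.induct) (auto simp: Let_def dest: postpone_starts)

lemma total_work_postpone_nonneg: "0 \<le> total_work (postpone I s P)"
  by (induction I s P rule: postpone.induct) (auto simp: Let_def)

lemma busy_postpone: "busy (postpone I s P) = {s..<s + total_work (postpone I s P)}"
proof (induction I s P rule: postpone.induct)
  case (2 I s i a b P)
  show ?case
  proof (cases "s < min (s + (b - a)) (deadline (I ! i))")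
    case True
    then show ?thesis
      using 2(1)[OF refl] total_work_postpone_nonneg[of I "min (s + (b - a)) (deadline (I ! i))" P] 
      by (auto simp: Let_def)
  next
    case False
    then show ?thesis using 2(2)[OF refl False] by (simp only: postpone.simps Let_def if_False)
  qed
qed auto

lemma postpone_deadline: "(i, a, b) \<in> set (postpone I s P) \<Longrightarrow> b \<le> deadline (I ! i)"
  by (induction I s P rule: postpone.induct) (auto simp: Let_def split: if_splits)

lemma postpone_jobs: "fst ` set (postpone I s P) \<subseteq> fst ` set P"
  by (induction I s P rule: postpone.induct) (auto simp: Let_def split: if_splits)

lemma postpone_cong:
  assumes "\<And>i. i \<in> fst ` set P \<Longrightarrow> I ! i = J ! i"
  shows "postpone I s P = postpone J s P"
  using assms by (induction I s P rule: postpone.induct) (auto simp: Let_def)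

lemma planned_work_postpone_le:
  "chronological P \<Longrightarrow> planned_work (postpone I s P) i \<le> planned_work P i"
proof (induction I s P rule: postpone.induct)
  case (2 I s j a b P)
  define e where "e = min (s + (b - a)) (deadline (I ! j))"
  have "a < b" "e \<le> s + (b - a)"
    using "2.prems" by (auto simp: e_def)
  then show ?case
    using 2 by (cases "s < e") (auto simp: Let_def e_def[symmetric] add_increasing)
qed auto

text \<open>A job loses work only when one of its pieces is truncated or dropped. At that moment the
  layout has reached its deadline, and later pieces only move the end further to the right.\<close>

lemma deadline_le_postpone:
  assumes "chronological P" "planned_work (postpone I s P) i \<noteq> planned_work P i"
  shows "deadline (I ! i) \<le> s + total_work (postpone I s P)"
  using assms
proof (induction I s P rule: postpone.induct)
  case (2 I s j a b P)
  define e where "e = min (s + (b - a)) (deadline (I ! j))"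
  show ?case
  proof (cases "s < e")
    case True
    then show ?thesis
      using 2 total_work_postpone_nonneg[of I e P] unfolding e_def
      by (auto simp: Let_def min_def split: if_splits)
  next
    case False
    then show ?thesis
      using 2 total_work_postpone_nonneg[of I s P] unfolding e_def
      by (auto simp: Let_def min_def split: if_splits)
  qed
qed auto

section \<open>The end of a plan, read off from its busy set\<close>

lemma piece_end_le:
  assumes "chronological P" "busy P \<subseteq> {..<z}" "(i, a, b) \<in> set P"
  shows "b \<le> z"
proof (rule ccontr)
  assume "\<not> b \<le> z"
  with chronological_less[OF assms(1,3)] have "max a z \<in> busy P"
    using assms(3) by (intro busyI[of i a b]) auto
  then show False using assms(2) by auto
qed

text \<open>\<open>plan_end\<close> inspects the last list entry, while the charging argument sees
  only busy sets. The last piece of a chronological plan ends at the supremum of the busy set, and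
  the nonempty interval \<open>{y..<z}\<close> forces this supremum to be \<open>z\<close>.\<close>

lemma plan_end_eq:
  assumes "chronological P" "busy P \<subseteq> {..<z}" "{y..<z} \<subseteq> busy P" "y < z"
  shows "plan_end t P = max t z"
proof -
  have "P \<noteq> []" using assms by auto
  obtain P' i a b where P: "P = P' @ [(i, a, b)]"
    using \<open>P \<noteq> []\<close> by (metis rev_exhaust surj_pair)
  have "a < b" "\<And>j a' b'. (j, a', b') \<in> set P' \<Longrightarrow> b' \<le> a" using assms(1) P by auto
  then have "busy P \<subseteq> {..<b}"
    using P by (fastforce elim!: busyE)
  have "b = z"
  proof (rule ccontr)
    assume "b \<noteq> z"
    then have "b < z" using piece_end_le[OF assms(1,2), of i a b] P by auto
    then have "max y b \<in> busy P" using assms(3,4) by (auto intro!: subsetD[OF assms(3)])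
    then show False using \<open>busy P \<subseteq> {..<b}\<close> by auto
  qed
  then show ?thesis using P by (simp add: plan_end_def)
qed

lemma busy_less_plan_end:
  assumes "chronological P"
  shows "busy P \<subseteq> {..<plan_end t P}"
proof (cases "P = []")
  case False
  then obtain P' i a b where P: "P = P' @ [(i, a, b)]"
    by (metis rev_exhaust surj_pair)
  have "a < b" "\<And>j a' b'. (j, a', b') \<in> set P' \<Longrightarrow> b' \<le> a" using assms(1) P by auto
  then show ?thesis
    using P by (fastforce elim!: busyE simp: plan_end_def)
qed auto

lemma plan_end_cases: "plan_end t P = t \<or> t < plan_end t P \<and> (\<exists>i a. (i, a, plan_end t P) \<in> set P)"
proof (cases "P = []")
  case False
  then obtain P' i a b where P: "P = P' @ [(i, a, b)]"
    by (metis rev_exhaust surj_pair)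
  then show ?thesis
    by (auto simp: plan_end_def max_def)
qed (auto simp: plan_end_def)

section \<open>Insertion of a job\<close>

text \<open>Besides validity, the invariant forbids idle time between the release of a job and the
  end of any of its pieces. This is what later places whole windows of lost jobs inside the busy
  set.\<close>

definition admissible :: "job list \<Rightarrow> nat \<Rightarrow> nat set \<Rightarrow> plan \<Rightarrow> bool" where
  "admissible I n A P \<longleftrightarrow> A \<subseteq> {..<n} \<and> chronological P \<and>
     (\<forall>(i, a, b) \<in> set P. i \<in> A \<and> release (I ! i) \<le> a \<and> b \<le> deadline (I ! i) \<and>
        {release (I ! i)..<b} \<subseteq> busy P) \<and>
     (\<forall>i \<in> A. planned_work P i \<le> proc (I ! i))"

lemma instances_release_mono:
  assumes "I \<in> instances" "i \<le> j" "j < length I"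
  shows "release (I ! i) \<le> release (I ! j)"
  using assms sorted_nth_mono[of "map release I" i j] by (auto simp: instances_def)

lemma instances_job:
  assumes "I \<in> instances" "i < length I"
  shows "0 < proc (I ! i)" "release (I ! i) + proc (I ! i) \<le> deadline (I ! i)"
  using assms nth_mem[of i I] by (auto simp: instances_def)

locale arrival =
  fixes I :: "job list" and n :: nat and A :: "nat set" and P :: plan
  assumes inst: "I \<in> instances" and n_less: "n < length I" and adm: "admissible I n A P"
begin

definition rel where "rel = release (I ! n)"
definition dl where "dl = deadline (I ! n)"
definition pr where "pr = proc (I ! n)"
definition cut where "cut = dl - pr"
definition fin where "fin = plan_end rel P"

lemma pr_pos: "0 < pr" and rel_le_cut: "rel \<le> cut" and cut_less_dl: "cut < dl"
  using instances_job[OF inst n_less] by (auto simp: pr_def rel_def cut_def dl_def)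

lemma job_less: "i \<in> A \<Longrightarrow> i < n"
  using adm by (auto simp: admissible_def)

lemma finite_jobs: "finite A"
  by (rule finite_subset[of _ "{..<n}"]) (auto dest: job_less)

lemma new_job: "n \<notin> A"
  using job_less by blast

lemma release_le_rel: "i < n \<Longrightarrow> release (I ! i) \<le> rel"
  using instances_release_mono[OF inst, of i n] n_less by (auto simp: rel_def)

lemma chrono: "chronological P"
  using adm by (auto simp: admissible_def)

lemma piece:
  assumes "(i, a, b) \<in> set P"
  shows "i \<in> A" "release (I ! i) \<le> a" "b \<le> deadline (I ! i)" "{release (I ! i)..<b} \<subseteq> busy P"
  using adm assms unfolding admissible_def by fastforce+

lemma jobs_subset: "fst ` set P \<subseteq> A"
  using piece(1) by auto

lemma planned_work_le: "i \<in> A \<Longrightarrow> planned_work P i \<le> proc (I ! i)"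
  using adm by (auto simp: admissible_def)

lemma planned_work_new: "planned_work P n = 0"
  using jobs_subset new_job by (intro planned_work_eq_0) auto

lemma rel_le_fin: "rel \<le> fin"
  by (auto simp: fin_def plan_end_def)

lemma busy_less_fin: "busy P \<subseteq> {..<fin}"
  using busy_less_plan_end[OF chrono] by (simp add: fin_def)

lemma piece_le_fin: "(i, a, b) \<in> set P \<Longrightarrow> b \<le> fin"
  using piece_end_le[OF chrono busy_less_fin] .

text \<open>If planned work remains at \<open>rel\<close>, some piece ends at \<open>fin\<close>,
  and its job was released no later than \<open>rel\<close>; the no-idle clause for this piece fills
  the interval.\<close>

lemma busy_until_fin: "{rel..<fin} \<subseteq> busy P"
proof -
  consider "fin = rel" | i a where "(i, a, fin) \<in> set P"
    using plan_end_cases[of rel P] by (auto simp: fin_def)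
  then show ?thesis
  proof cases
    case 2
    then show ?thesis
      using piece(4)[OF 2] release_le_rel[OF job_less[OF piece(1)[OF 2]]] by auto
  qed auto
qed

text \<open>A piece that ends at or after \<open>rel\<close> puts its job into the current busy
  period: the no-idle clause accounts for the time before \<open>rel\<close>,
  \<open>busy_until_fin\<close> for the rest.\<close>

lemma busy_release_fin:
  assumes "(i, a, b) \<in> set P" "rel \<le> b"
  shows "{release (I ! i)..<fin} \<subseteq> busy P"
proof
  fix t assume "t \<in> {release (I ! i)..<fin}"
  then show "t \<in> busy P"
    using piece(4)[OF assms(1)] busy_until_fin assms(2) by (cases "t < rel") auto
qed

lemma admissible_append:
  assumes "fin + pr \<le> dl"
  shows "admissible I (Suc n) (insert n A) (P @ [(n, fin, fin + pr)])"
  unfolding admissible_def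
proof (intro conjI)
  show "insert n A \<subseteq> {..<Suc n}" using job_less by fastforce
  show "chronological (P @ [(n, fin, fin + pr)])"
    using chrono pr_pos piece_le_fin by auto
  have "{rel..<fin + pr} \<subseteq> busy P \<union> {fin..<fin + pr}"
    using busy_until_fin by auto
  moreover have "i \<in> A \<and> release (I ! i) \<le> a \<and> b \<le> deadline (I ! i) \<and> {release (I ! i)..<b} \<subseteq> busy P"
    if "(i, a, b) \<in> set P" for i a b
    using piece[OF that] by blast
  ultimately show "\<forall>(i, a, b)\<in>set (P @ [(n, fin, fin + pr)]). i \<in> insert n A \<and> release (I ! i) \<le> a \<and>
      b \<le> deadline (I ! i) \<and> {release (I ! i)..<b} \<subseteq> busy (P @ [(n, fin, fin + pr)])"
    using assms rel_le_fin by (fastforce simp: rel_def dl_def)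
  show "\<forall>i\<in>insert n A. planned_work (P @ [(n, fin, fin + pr)]) i \<le> proc (I ! i)"
    using planned_work_le new_job planned_work_new by (auto simp: pr_def)
qed

end

section \<open>The new job does not fit at the end of the plan\<close>

locale overload = arrival +
  assumes tight: "dl < fin + pr"
begin

definition moved where "moved = plan_after cut (plan_before dl P)"
definition laid where "laid = postpone I (max dl fin) moved"
definition new_end where "new_end = max dl fin + total_work laid"
definition new_plan where
  "new_plan = plan_before cut P @ [(n, cut, dl)] @ plan_after dl P @ laid"

lemma insert_job_eq: "insert_job I n P = new_plan"
  by (simp add: insert_job_def new_plan_def Let_def laid_def moved_def rel_def dl_def fin_def cut_def pr_def)

lemma cut_less_fin: "cut < fin"
  using tight by (simp add: cut_def)

lemma rel_less_fin: "rel < fin"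
  using cut_less_fin rel_le_cut by simp

lemma plan_end_fin: "plan_end t P = max t fin"
  using plan_end_eq[OF chrono busy_less_fin busy_until_fin rel_less_fin] .

lemma moved_piece:
  assumes "(i, a, b) \<in> set moved"
  obtains a' b' where "(i, a', b') \<in> set P" "b \<le> b'" "cut < b'"
  using assms by (auto simp: moved_def set_plan_after set_plan_before)

lemma chrono_moved: "chronological moved"
  by (simp add: moved_def chronological_plan_after chronological_plan_before chrono)

lemma chrono_laid: "chronological laid"
  by (simp add: laid_def chronological_postpone)

lemma busy_moved: "busy moved = {cut..<min dl fin}"
proof -
  have "busy moved = busy P \<inter> {cut..<dl}"
    by (auto simp: moved_def busy_plan_after busy_plan_before)
  \<comment> \<open>As \<open>rel \<le> cut\<close>, the plan has no gap between \<open>cut\<close>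
    and \<open>fin\<close>.\<close>
  also have "\<dots> = {cut..<min dl fin}"
    using busy_less_fin busy_until_fin rel_le_cut by fastforce
  finally show ?thesis .
qed

lemma total_work_moved: "total_work moved = min dl fin - cut"
  using measure_busy[OF chrono_moved] cut_less_fin cut_less_dl by (simp add: busy_moved)

lemma busy_laid: "busy laid = {max dl fin..<new_end}"
  by (simp add: laid_def new_end_def busy_postpone)

lemma laid_piece:
  assumes "(i, a, b) \<in> set laid"
  shows "dl \<le> a" "fin \<le> a" "b \<le> deadline (I ! i)" "b \<le> new_end"
proof -
  show "dl \<le> a" "fin \<le> a" "b \<le> deadline (I ! i)"
    using postpone_starts[of i a b I "max dl fin" moved] postpone_deadline[of i a b I "max dl fin" moved] assms
    by (auto simp: laid_def)
  show "b \<le> new_end"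
    by (rule piece_end_le[OF chrono_laid _ assms]) (rule subsetI, simp add: busy_laid)
qed

lemma max_le_new_end: "dl \<le> new_end" "fin \<le> new_end"
  using total_work_postpone_nonneg[of I "max dl fin" moved]
  by (auto simp: new_end_def laid_def)

lemma laid_jobs: "fst ` set laid \<subseteq> fst ` set moved"
  by (simp add: laid_def postpone_jobs)

lemma moved_jobs: "fst ` set moved \<subseteq> A"
proof safe
  fix i a b assume "(i, a, b) \<in> set moved"
  then show "fst (i, a, b) \<in> A" by (metis moved_piece piece(1) fst_conv)
qed

text \<open>No gap arises: \<open>cut < fin\<close> lets the new job adjoin the old busy period, and
  the postponed work starts exactly at \<open>max dl fin\<close>. Busy time never becomes idle, so
  idle time that has been paid for can only shrink.\<close>

lemma busy_new_plan: "busy new_plan = busy P \<union> {rel..<new_end}"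
proof -
  have "busy new_plan = busy P \<inter> {..<cut} \<union> {cut..<dl} \<union> busy P \<inter> {dl..} \<union> {max dl fin..<new_end}"
    by (simp add: new_plan_def busy_plan_before busy_plan_after busy_laid Un_assoc)
  also have "\<dots> = busy P \<union> {rel..<new_end}" (is "?L = ?R")
  proof (intro set_eqI)
    fix t
    consider "t < rel" | "rel \<le> t" "t < fin" | "fin \<le> t" by linarith
    then show "t \<in> ?L \<longleftrightarrow> t \<in> ?R"
    proof cases
      case 2
      then have "t \<in> busy P" using busy_until_fin by auto
      then show ?thesis using 2 max_le_new_end by auto
    next
      case 3
      then have "t \<notin> busy P" using busy_less_fin by auto
      then show ?thesis using 3 max_le_new_end rel_less_fin cut_less_fin by auto
    qed (use rel_le_cut cut_less_dl rel_less_fin in auto)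
  qed
  finally show ?thesis .
qed

lemma plan_end_new_plan:
  assumes "chronological new_plan"
  shows "plan_end t new_plan = max t new_end"
proof (rule plan_end_eq[OF assms, of _ rel])
  show "busy new_plan \<subseteq> {..<new_end}"
    using busy_less_fin max_le_new_end by (auto simp: busy_new_plan)
qed (use busy_new_plan rel_less_fin max_le_new_end in auto)

lemma chrono_new_plan: "chronological new_plan"
proof -
  have "b \<le> a'" if "(j, a', b') \<in> set laid" "(i, a, b) \<in> set P" for i a b j a' b'
    using laid_piece(2)[OF that(1)] piece_le_fin[OF that(2)] by simp
  then have "chronological (plan_after dl P @ laid)"
    using chrono chrono_laid by (fastforce simp: chronological_plan_after set_plan_after)
  moreover have "dl \<le> a" if "(i, a, b) \<in> set (plan_after dl P @ laid)" for i a b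
    using that laid_piece(1)[of i a b] by (auto simp: set_plan_after)
  ultimately have "chronological ([(n, cut, dl)] @ plan_after dl P @ laid)"
    using cut_less_dl by auto
  moreover have "cut \<le> a" if "(i, a, b) \<in> set ([(n, cut, dl)] @ plan_after dl P @ laid)" for i a b
    using that laid_piece(1)[of i a b] cut_less_dl by (auto simp: set_plan_after)
  moreover have "b \<le> cut" if "(i, a, b) \<in> set (plan_before cut P)" for i a b
    using that by (auto simp: set_plan_before)
  ultimately show ?thesis
    unfolding new_plan_def chronological_simps(3)[of "plan_before cut P"]
    using chronological_plan_before[OF chrono] by fastforce
qed

lemma planned_work_new_plan:
  "planned_work new_plan i = planned_work P i - (planned_work moved i - planned_work laid i) +
     (if i = n then pr else 0)"
proof -
  have "planned_work P i = planned_work (plan_before dl P) i + planned_work (plan_after dl P) i"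
    using planned_work_split[OF chrono] by simp
  also have "planned_work (plan_before dl P) i =
      planned_work (plan_before cut (plan_before dl P)) i + planned_work moved i"
    using planned_work_split[OF chronological_plan_before[OF chrono]] by (simp add: moved_def)
  also have "plan_before cut (plan_before dl P) = plan_before cut P"
    using cut_less_dl by (induction P) (auto simp: min_def)
  finally show ?thesis
    by (simp add: new_plan_def cut_def)
qed

lemma planned_work_laid_le: "planned_work laid i \<le> planned_work moved i"
  using planned_work_postpone_le[OF chrono_moved] by (simp add: laid_def)

lemma planned_work_new_plan_old: 
  assumes "i \<in> A"
  shows "planned_work new_plan i = planned_work P i - (planned_work moved i - planned_work laid i)"
  using assms new_job by (auto simp: planned_work_new_plan)

lemma planned_work_new_plan_new: "planned_work new_plan n = pr"
proof -
  have "planned_work moved n = 0" "planned_work laid n = 0"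
    using moved_jobs laid_jobs new_job by (blast intro: planned_work_eq_0)+
  then show ?thesis by (simp add: planned_work_new_plan planned_work_new)
qed

lemma admissible_new_plan: "admissible I (Suc n) (insert n A) new_plan"
  unfolding admissible_def
proof (intro conjI)
  show "insert n A \<subseteq> {..<Suc n}" using job_less by fastforce
  show "chronological new_plan" by (rule chrono_new_plan)
  show "\<forall>i\<in>insert n A. planned_work new_plan i \<le> proc (I ! i)"
  proof
    fix i assume "i \<in> insert n A"
    then show "planned_work new_plan i \<le> proc (I ! i)"
      using planned_work_new_plan_old[of i] planned_work_new_plan_new planned_work_laid_le[of i]
        planned_work_le[of i] by (auto simp: pr_def)
  qed
  show "\<forall>(i, a, b)\<in>set new_plan. i \<in> insert n A \<and> release (I ! i) \<le> a \<and> b \<le> deadline (I ! i) \<and>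
      {release (I ! i)..<b} \<subseteq> busy new_plan"
  proof clarify
    fix i a b assume "(i, a, b) \<in> set new_plan"
    then consider b' where "(i, a, b') \<in> set P" "b = min b' cut" | "i = n" "a = cut" "b = dl"
      | a' where "(i, a', b) \<in> set P" "a = max a' dl" | "(i, a, b) \<in> set laid"
      by (auto simp: new_plan_def set_plan_before set_plan_after)
    then show "i \<in> insert n A \<and> release (I ! i) \<le> a \<and> b \<le> deadline (I ! i) \<and>
      {release (I ! i)..<b} \<subseteq> busy new_plan"
    proof cases
      case 1
      then show ?thesis using piece[OF 1(1)] by (auto simp: busy_new_plan)
    next
      case 2
      then show ?thesis using rel_le_cut max_le_new_end 
        by (auto simp: busy_new_plan rel_def[symmetric] dl_def[symmetric])
    next
      case 3
      then show ?thesis using piece[OF 3(1)] by (auto simp: busy_new_plan)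
    next
      case 4
      have "i \<in> fst ` set moved" using laid_jobs 4 by force
      then obtain a' b' where "(i, a', b') \<in> set moved" by auto
      then obtain a'' b'' where P: "(i, a'', b'') \<in> set P" "cut < b''"
        by (rule moved_piece)
      have "release (I ! i) \<le> rel" using release_le_rel[OF job_less[OF piece(1)[OF P(1)]]] .
      moreover have "{release (I ! i)..<fin} \<subseteq> busy P"
        using busy_release_fin[OF P(1)] P(2) rel_le_cut by auto
      ultimately show ?thesis
        using piece(1)[OF P(1)] rel_le_fin laid_piece[OF 4] by (auto simp: busy_new_plan)
    qed
  qed
qed

lemma affected_eq: "affected A P new_plan = {i \<in> A. planned_work laid i \<noteq> planned_work moved i}"
  using planned_work_new_plan_old by (auto simp: affected_def)

text \<open>An affected job lost work in the layout, so its deadline is at most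
  \<open>new_end\<close>. It also has a piece ending after \<open>cut\<close>, hence belongs to the
  current busy period and saw no idle time since its release.\<close>

lemma affected_window:
  assumes "i \<in> affected A P new_plan"
  shows "{release (I ! i)..<deadline (I ! i)} \<subseteq> busy P \<union> {fin..<new_end}"
    and "\<exists>a b. (i, a, b) \<in> set P \<and> cut < b"
proof -
  have "planned_work laid i \<noteq> planned_work moved i" using assms by (simp add: affected_eq)
  then have dl: "deadline (I ! i) \<le> new_end"
    using deadline_le_postpone[OF chrono_moved] by (simp add: laid_def new_end_def)
  have "i \<in> fst ` set moved"
  proof (rule ccontr)
    assume "i \<notin> fst ` set moved"
    moreover from this have "i \<notin> fst ` set laid" using laid_jobs by blast
    ultimately show False
      using \<open>planned_work laid i \<noteq> planned_work moved i\<close> by (simp add: planned_work_eq_0)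
  qed
  then obtain a b where "(i, a, b) \<in> set moved" by auto
  then obtain a' b' where P: "(i, a', b') \<in> set P" "cut < b'"
    by (rule moved_piece)
  then show "\<exists>a b. (i, a, b) \<in> set P \<and> cut < b" by blast
  have "{release (I ! i)..<fin} \<subseteq> busy P"
    using busy_release_fin[OF P(1)] P(2) rel_le_cut by auto
  moreover have "t \<in> {release (I ! i)..<fin} \<or> t \<in> {fin..<new_end}"
    if "t \<in> {release (I ! i)..<deadline (I ! i)}" for t
    using that dl by (cases "t < fin") simp_all
  ultimately show "{release (I ! i)..<deadline (I ! i)} \<subseteq> busy P \<union> {fin..<new_end}"
    by blast
qed

text \<open>Work of length \<open>min dl fin - cut\<close> is taken out and
  \<open>new_end - max dl fin\<close> is put back. Minimum and maximum add up to
  \<open>dl + fin\<close>, and \<open>dl - cut = pr\<close>.\<close>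

lemma sum_lost: "(\<Sum>i\<in>A. planned_work P i - planned_work new_plan i) = fin + pr - new_end"
proof -
  have "(\<Sum>i\<in>A. planned_work P i - planned_work new_plan i) =
      (\<Sum>i\<in>A. planned_work moved i) - (\<Sum>i\<in>A. planned_work laid i)"
    by (simp add: planned_work_new_plan_old sum_subtractf)
  also have "\<dots> = total_work moved - total_work laid"
    using moved_jobs laid_jobs by (simp add: sum_planned_work[OF finite_jobs])
  finally show ?thesis
    by (simp add: total_work_moved new_end_def cut_def)
qed

text \<open>The attributed penalty is the work lost by old jobs, and jobs that are not affected
  contribute 0, so the sum may range over all of \<open>A\<close>.\<close>

lemma profit_accept_eq: "profit_accept I A P new_plan n = new_end - fin"
proof -
  have "(\<Sum>i \<in> affected A P new_plan. planned_shortage I new_plan i - planned_shortage I P i) =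
      (\<Sum>i\<in>A. planned_work P i - planned_work new_plan i)"
    by (rule sum.mono_neutral_cong_left) (auto simp: finite_jobs affected_def planned_shortage_def)
  then show ?thesis by (simp add: profit_accept_def sum_lost job_value_def pr_def)
qed

definition spoiled where
  "spoiled = {i \<in> affected A P new_plan. proc (I ! i) \<le> planned_work P i}"

text \<open>The invariant never plans more than \<open>proc\<close>, so a job counted here is
  planned exactly and its shortage vanishes.\<close>

lemma profit_decline_eq: "profit_decline I A P new_plan = (\<Sum>i\<in>spoiled. proc (I ! i))"
  unfolding profit_decline_def spoiled_def[symmetric]
proof (rule sum.cong[OF refl])
  fix i assume "i \<in> spoiled"
  then have "planned_work P i = proc (I ! i)"
    using planned_work_le[of i] by (simp add: spoiled_def affected_def)
  then show "job_value (I ! i) - planned_shortage I P i = proc (I ! i)"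
    by (simp add: planned_shortage_def job_value_def)
qed

end

section \<open>Causality of DSC\<close>

definition dsc_state :: "real \<Rightarrow> job list \<Rightarrow> nat \<Rightarrow> nat set \<times> plan" where
  "dsc_state \<beta> I n = fold (dsc_step \<beta> I) [0..<n] ({}, [])"

lemma dsc_state_simps [simp]:
  "dsc_state \<beta> I 0 = ({}, [])"
  "dsc_state \<beta> I (Suc n) = dsc_step \<beta> I n (dsc_state \<beta> I n)"
  by (simp_all add: dsc_state_def)

lemma dsc_eq: "dsc_state \<beta> I (length I) = (A, P) \<Longrightarrow> dsc \<beta> I = (A, plan_schedule P)"
  by (simp add: dsc_def dsc_state_def)

lemma plan_schedule_cong:
  assumes "chronological P" "chronological Q"
    and "\<And>i. t \<in> busy (filter (\<lambda>q. fst q = i) P) \<longleftrightarrow> t \<in> busy (filter (\<lambda>q. fst q = i) Q)"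
  shows "plan_schedule P t = plan_schedule Q t"
proof -
  have "plan_schedule P t = Some i \<longleftrightarrow> plan_schedule Q t = Some i" for i
    using assms by (simp add: plan_schedule_iff)
  then show ?thesis by (metis not_Some_eq)
qed

lemma (in arrival) overload_intro: "\<not> fin + pr \<le> dl \<Longrightarrow> overload I n A P"
  by unfold_locales simp

lemma (in arrival) dsc_step_append:
  "fin + pr \<le> dl \<Longrightarrow> dsc_step \<beta> I n (A, P) = (insert n A, P @ [(n, fin, fin + pr)])"
  by (simp add: dsc_step_def Let_def fin_def pr_def dl_def rel_def)

lemma (in overload) dsc_step_insert:
  "dsc_step \<beta> I n (A, P) =
     (if new_end - fin > \<beta> * (\<Sum>i\<in>spoiled. proc (I ! i)) then (insert n A, new_plan) else (A, P))"
  using tight profit_accept_eq profit_decline_eq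
  by (simp add: dsc_step_def Let_def insert_job_eq fin_def pr_def dl_def rel_def)

lemma (in arrival) admissible_Suc: "admissible I (Suc n) A P"
  using adm by (force simp: admissible_def)

lemma (in arrival) admissible_step:
  "case dsc_step \<beta> I n (A, P) of (A', P') \<Rightarrow> admissible I (Suc n) A' P'"
proof (cases "fin + pr \<le> dl")
  case True
  then show ?thesis using admissible_append by (simp add: dsc_step_append)
next
  case False
  then interpret overload I n A P by (rule overload_intro)
  show ?thesis using admissible_new_plan admissible_Suc by (simp add: dsc_step_insert)
qed

lemma admissible_dsc_state:
  assumes "I \<in> instances" "n \<le> length I" "dsc_state \<beta> I n = (A, P)"
  shows "admissible I n A P"
  using assms(2,3)
proof (induction n arbitrary: A P)
  case (Suc n)
  obtain A' P' where s: "dsc_state \<beta> I n = (A', P')" by fastforce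
  interpret arrival I n A' P'
    using Suc assms(1) s by unfold_locales auto
  show ?case using admissible_step[of \<beta>] Suc.prems s by simp
qed (simp add: admissible_def)

text \<open>Insertion alters the plan only from \<open>cut\<close> on, and
  \<open>rel \<le> cut\<close>.\<close>

lemma (in overload) plan_schedule_new_plan:
  assumes "t < rel"
  shows "plan_schedule new_plan t = plan_schedule P t"
proof (rule plan_schedule_cong[OF chrono_new_plan chrono])
  fix i
  have "t \<notin> busy (filter (\<lambda>q. fst q = i) laid)"
    using assms rel_less_fin by (fastforce elim!: busyE dest: laid_piece(2))
  then show "t \<in> busy (filter (\<lambda>q. fst q = i) new_plan) \<longleftrightarrow> t \<in> busy (filter (\<lambda>q. fst q = i) P)"
    using assms rel_le_cut cut_less_dl busy_filter_plan_before[of "\<lambda>j. j = i"]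
      busy_filter_plan_after[of "\<lambda>j. j = i"]
    by (auto simp: new_plan_def simp del: busy_simps(2) split: if_splits)
       (auto simp: busy_def)
qed

lemma (in arrival) dsc_step_past:
  assumes "dsc_step \<beta> I n (A, P) = (A', P')"
  shows "i \<noteq> n \<Longrightarrow> i \<in> A' \<longleftrightarrow> i \<in> A"
    and "t < rel \<Longrightarrow> plan_schedule P' t = plan_schedule P t"
proof -
  have "(i \<noteq> n \<longrightarrow> (i \<in> A' \<longleftrightarrow> i \<in> A)) \<and> (t < rel \<longrightarrow> plan_schedule P' t = plan_schedule P t)"
  proof (cases "fin + pr \<le> dl")
    case True
    have "chronological (P @ [(n, fin, fin + pr)])"
      using admissible_append[OF True] by (simp add: admissible_def)
    then have "t < rel \<Longrightarrow> plan_schedule (P @ [(n, fin, fin + pr)]) t = plan_schedule P t"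
      using chrono rel_le_fin by (auto intro!: plan_schedule_cong split: if_splits)
    then show ?thesis using assms dsc_step_append[OF True] by auto
  next
    case False
    then interpret overload I n A P by (rule overload_intro)
    show ?thesis using assms plan_schedule_new_plan by (auto simp: dsc_step_insert split: if_splits)
  qed
  then show "i \<noteq> n \<Longrightarrow> i \<in> A' \<longleftrightarrow> i \<in> A"
    and "t < rel \<Longrightarrow> plan_schedule P' t = plan_schedule P t" by blast+
qed

lemma dsc_state_past:
  assumes "I \<in> instances" "m \<le> n" "n \<le> length I" "\<And>j. m \<le> j \<Longrightarrow> j < length I \<Longrightarrow> t < release (I ! j)"
    and "dsc_state \<beta> I m = (A, P)" "dsc_state \<beta> I n = (A', P')"
  shows "i < m \<Longrightarrow> i \<in> A' \<longleftrightarrow> i \<in> A" and "s \<le> t \<Longrightarrow> plan_schedule P' s = plan_schedule P s"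
proof -
  have "(i < m \<longrightarrow> (i \<in> A' \<longleftrightarrow> i \<in> A)) \<and> (s \<le> t \<longrightarrow> plan_schedule P' s = plan_schedule P s)"
    using assms(2,3,6)
  proof (induction n arbitrary: A' P' rule: dec_induct)
    case base
    then show ?case using assms(5) by simp
  next
    case (step n)
    obtain A1 P1 where s: "dsc_state \<beta> I n = (A1, P1)" by fastforce
    interpret arrival I n A1 P1
      using step assms(1) s admissible_dsc_state by unfold_locales auto
    have "dsc_step \<beta> I n (A1, P1) = (A', P')" using step.prems s by simp
    note past = dsc_step_past[OF this]
    have "t < rel" using assms(4) step by (simp add: rel_def)
    then show ?case using step.IH[OF _ s] step past(1)[of i] past(2)[of s] by simp
  qed
  then show "i < m \<Longrightarrow> i \<in> A' \<longleftrightarrow> i \<in> A" and "s \<le> t \<Longrightarrow> plan_schedule P' s = plan_schedule P s"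
    by blast+
qed

text \<open>A step consults only the arriving job and jobs in \<open>A\<close>; the pieces that get
  postponed belong to \<open>A\<close> as well.\<close>

lemma dsc_step_cong:
  assumes "\<And>i. i \<le> n \<Longrightarrow> I ! i = J ! i" "A \<subseteq> {..<n}" "fst ` set P \<subseteq> A"
  shows "dsc_step \<beta> I n (A, P) = dsc_step \<beta> J n (A, P)"
proof -
  have n: "I ! n = J ! n" using assms(1) by simp
  have A: "I ! i = J ! i" if "i \<in> A" for i using assms(1,2) that by fastforce
  have "fst ` set (plan_after c (plan_before d P)) \<subseteq> fst ` set P" for c d
    by (force simp: set_plan_after set_plan_before)
  then have "postpone I s (plan_after c (plan_before d P)) = postpone J s (plan_after c (plan_before d P))" for s c d
    using assms(3) A by (intro postpone_cong) blast
  then have ins: "insert_job I n P = insert_job J n P"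
    by (simp add: insert_job_def n)
  have "profit_accept I A P Q n = profit_accept J A P Q n" for Q
    unfolding profit_accept_def n
    by (intro arg_cong2[where f = "(-)"] refl sum.cong) (auto simp: affected_def planned_shortage_def A)
  moreover have "profit_decline I A P Q = profit_decline J A P Q" for Q
    unfolding profit_decline_def
    by (intro sum.cong) (auto simp: affected_def planned_shortage_def A)
  ultimately show ?thesis
    by (simp add: dsc_step_def n ins Let_def)
qed

lemma dsc_state_cong:
  assumes "I \<in> instances" "n \<le> length I" "n \<le> length J" "take n I = take n J"
  shows "dsc_state \<beta> I n = dsc_state \<beta> J n"
  using assms(2-4)
proof (induction n)
  case (Suc n)
  obtain A P where s: "dsc_state \<beta> I n = (A, P)" by fastforce
  interpret arrival I n A P
    using Suc assms(1) s admissible_dsc_state by unfold_locales auto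
  have eq: "I ! i = J ! i" if "i \<le> n" for i
    using Suc.prems that by (metis less_Suc_eq_le nth_take)
  have "take n I = take n J"
    using arg_cong[OF Suc.prems(3), of "take n"] by simp
  then have "dsc_state \<beta> I n = dsc_state \<beta> J n" using Suc by simp
  moreover have "dsc_step \<beta> I n (A, P) = dsc_step \<beta> J n (A, P)"
    using eq job_less jobs_subset by (intro dsc_step_cong) auto
  ultimately show ?case using s by simp
qed simp

lemma released_by_take:
  fixes t :: real
  assumes "I \<in> instances"
  defines "m \<equiv> length (released_by t I)"
  shows "released_by t I = take m I" "m \<le> length I" "m \<le> j \<Longrightarrow> j < length I \<Longrightarrow> t < release (I ! j)"
proof -
  have "sorted (map release I)" using assms by (simp add: instances_def)
  then have "released_by t I = take m I \<and> (\<forall>j. m \<le> j \<longrightarrow> j < length I \<longrightarrow> t < release (I ! j))"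
    unfolding m_def
  proof (induction I)
    case (Cons T I)
    show ?case
    proof (cases "release T \<le> t")
      case True
      then show ?thesis using Cons by (auto simp: released_by_def nth_Cons split: nat.splits)
    next
      case False
      then have "released_by t (T # I) = []" "\<forall>S\<in>set (T # I). t < release S"
        using Cons.prems by (auto simp: released_by_def filter_empty_conv)
      then show ?thesis by (metis list.size(3) nth_mem take0)
    qed
  qed (simp add: released_by_def)
  then show "released_by t I = take m I" "m \<le> j \<Longrightarrow> j < length I \<Longrightarrow> t < release (I ! j)" by blast+
  show "m \<le> length I" by (simp add: m_def released_by_def)
qed

lemma admissible_valid_outcome:
  assumes "admissible I (length I) A P"
  shows "valid_outcome I (A, plan_schedule P)"
proof -
  have P: "chronological P" using assms by (simp add: admissible_def)
  have "{t. plan_schedule P t = Some i} = busy (filter (\<lambda>q. fst q = i) P)" for i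
    using P by (auto simp: plan_schedule_iff)
  moreover have "i \<in> A \<and> release (I ! i) \<le> t \<and> t \<le> deadline (I ! i)" if some: "plan_schedule P t = Some i" for t i
  proof -
    obtain a b where "(i, a, b) \<in> set P" "a \<le> t" "t < b"
      using some P by (fastforce simp: plan_schedule_iff elim!: busyE)
    moreover from this have "i \<in> A \<and> release (I ! i) \<le> a \<and> b \<le> deadline (I ! i)"
      using assms by (auto simp: admissible_def)
    ultimately show ?thesis by auto
  qed
  ultimately show ?thesis
    using assms by (auto simp: valid_outcome_def admissible_def fmeasurableD)
qed

lemma online_scheduler_dsc: "online_scheduler (dsc \<beta>)"
  unfolding online_scheduler_def
proof (intro conjI ballI allI impI)
  fix I assume "I \<in> instances"
  obtain A P where s: "dsc_state \<beta> I (length I) = (A, P)" by fastforce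
  then show "valid_outcome I (dsc \<beta> I)"
    using admissible_dsc_state[OF \<open>I \<in> instances\<close> order_refl s] by (simp add: dsc_eq admissible_valid_outcome)
next
  fix I J t assume I: "I \<in> instances" and J: "J \<in> instances" and eq: "released_by t I = released_by t J"
  define m where "m = length (released_by t I)"
  note rI = released_by_take[OF I, of t, folded m_def]
  note rJ = released_by_take[OF J, of t, folded eq, folded m_def]
  \<comment> \<open>Both runs pass through this state after the \<open>m\<close> jobs released by
    \<open>t\<close>. All later arrivals leave the decisions on these jobs and the schedule up to
    \<open>t\<close> as they are.\<close>
  obtain A P where s: "dsc_state \<beta> I m = (A, P)" by fastforce
  have "take m I = take m J" using rI(1) rJ(1) by simp
  then have s': "dsc_state \<beta> J m = (A, P)" using dsc_state_cong[OF I, of m J] rI(2) rJ(2) s by simp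
  obtain A1 P1 A2 P2 where f: "dsc_state \<beta> I (length I) = (A1, P1)" "dsc_state \<beta> J (length J) = (A2, P2)" 
    by fastforce
  note past1 = dsc_state_past[OF I rI(2) order_refl rI(3) s f(1)]
  note past2 = dsc_state_past[OF J rJ(2) order_refl rJ(3) s' f(2)]
  show "i \<in> fst (dsc \<beta> I) \<longleftrightarrow> i \<in> fst (dsc \<beta> J)" if "i < length (released_by t I)" for i
    using past1(1) past2(1) that f by (simp add: dsc_eq m_def)
  show "snd (dsc \<beta> I) s = snd (dsc \<beta> J) s" if "s \<le> t" for s
    using past1(2) past2(2) that f by (simp add: dsc_eq)
qed

section \<open>Bounds on the offline optimum\<close>

text \<open>Processing sets of different jobs are disjoint, so their measures add up inside
  \<open>U\<close>. The finite set \<open>N\<close> absorbs single instants: a valid outcome may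
  process a job at its very deadline, while the windows used in the charging are half open.\<close>

lemma measure_disjoint_windows:
  assumes "finite X" "\<And>i. i \<in> X \<Longrightarrow> {t. \<sigma> t = Some i} \<in> sets lebesgue"
    and "\<And>i t. i \<in> X \<Longrightarrow> \<sigma> t = Some i \<Longrightarrow> t \<in> U \<or> t \<in> N" "U \<in> lmeasurable" "finite N"
  shows "(\<Sum>i\<in>X. received \<sigma> i) \<le> measure lebesgue U"
proof -
  define G where "G i = {t. \<sigma> t = Some i} - N" for i
  have N: "N \<in> null_sets lebesgue"
    using negligible_finite[OF assms(5)] by (simp only: negligible_iff_null_sets)
  have sub: "G i \<subseteq> U" if "i \<in> X" for i using assms(3)[OF that] by (auto simp: G_def)
  have meas: "G i \<in> lmeasurable" if "i \<in> X" for i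
  proof (rule fmeasurableI2[OF assms(4) sub[OF that]])
    show "G i \<in> sets lebesgue"
      unfolding G_def using assms(2)[OF that] null_setsD2[OF N] by (rule sets.Diff)
  qed
  have "received \<sigma> i = measure lebesgue (G i)" if "i \<in> X" for i
    unfolding received_def G_def using measure_Diff_null_set[OF assms(2)[OF that] N] by simp
  then have "(\<Sum>i\<in>X. received \<sigma> i) = (\<Sum>i\<in>X. measure lebesgue (G i))"
    by (rule sum.cong[OF refl])
  also have "\<dots> = measure lebesgue (\<Union>i\<in>X. G i)"
    by (rule measure_UNION'[OF assms(1) meas, symmetric]) (auto simp: pairwise_def disjnt_def G_def)
  also have "\<dots> \<le> measure lebesgue U"
  proof (rule measure_mono_fmeasurable[OF _ _ assms(4)])
    show "(\<Union>i\<in>X. G i) \<in> sets lebesgue"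
      using meas by (intro sets.finite_UN[OF assms(1)] fmeasurableD)
  qed (use sub in blast)
  finally show ?thesis .
qed

text \<open>An accepted job contributes at most \<open>proc\<close> and also at most the processing
  it receives, because an unfinished job contributes nothing positive. Jobs confined to
  \<open>U\<close> are bounded the second way, all others the first way.\<close>

lemma profit_le:
  assumes "valid_outcome I x" "X \<subseteq> {..<length I}" "U \<in> lmeasurable" "I \<in> instances"
    and "\<And>i. i \<in> X \<Longrightarrow> {release (I ! i)..<deadline (I ! i)} \<subseteq> U"
  shows "profit I x \<le> (\<Sum>i\<in>{..<length I} - X. proc (I ! i)) + measure lebesgue U"
proof -
  obtain A \<sigma> where x: "x = (A, \<sigma>)" by (cases x)
  have A: "A \<subseteq> {..<length I}" and \<sigma>: "\<And>i. {t. \<sigma> t = Some i} \<in> sets lebesgue"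
    and win: "\<And>t i. \<sigma> t = Some i \<Longrightarrow> release (I ! i) \<le> t \<and> t \<le> deadline (I ! i)"
    using assms(1) by (auto simp: valid_outcome_def x)
  have fin: "finite A" using A finite_subset by blast
  have pos: "0 < proc (I ! i)" if "i < length I" for i
    using instances_job(1)[OF assms(4) that] .
  have nonneg: "0 \<le> proc (I ! i)" "0 \<le> received \<sigma> i" if "i \<in> A" for i
    using pos[of i] A that by (auto simp: received_def)
  define g where "g i = (if proc (I ! i) \<le> received \<sigma> i then job_value (I ! i)
     else - (proc (I ! i) - received \<sigma> i))" for i
  have g: "g i \<le> proc (I ! i)" "g i \<le> received \<sigma> i" if "i \<in> A" for i
    using nonneg[OF that] by (auto simp: g_def job_value_def)
  have "profit I x = (\<Sum>i\<in>A. g i)" by (simp add: profit_def x g_def)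
  also have "\<dots> = (\<Sum>i\<in>A - X. g i) + (\<Sum>i\<in>A \<inter> X. g i)"
    using fin by (metis add.commute sum.Int_Diff)
  also have "(\<Sum>i\<in>A - X. g i) \<le> (\<Sum>i\<in>A - X. proc (I ! i))"
    by (intro sum_mono) (use g in blast)
  also have "\<dots> \<le> (\<Sum>i\<in>{..<length I} - X. proc (I ! i))"
    using A pos by (intro sum_mono2) (auto intro: less_imp_le)
  also have "(\<Sum>i\<in>A \<inter> X. g i) \<le> (\<Sum>i\<in>A \<inter> X. received \<sigma> i)"
    by (intro sum_mono) (use g in blast)
  also have "\<dots> \<le> measure lebesgue U"
  proof (rule measure_disjoint_windows[where N = "(\<lambda>i. deadline (I ! i)) ` {..<length I}"])
    fix i t assume i: "i \<in> A \<inter> X" "\<sigma> t = Some i"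
    show "t \<in> U \<or> t \<in> (\<lambda>i. deadline (I ! i)) ` {..<length I}"
    proof (cases "t = deadline (I ! i)")
      case False
      then have "t \<in> {release (I ! i)..<deadline (I ! i)}" using win[OF i(2)] by auto
      then show ?thesis using assms(5) i(1) by blast
    qed (use i A in auto)
  qed (use fin \<sigma> assms(3) in auto)
  finally show ?thesis by simp
qed

lemma valid_outcome_empty: "valid_outcome I ({}, \<lambda>_. None)"
  by (simp add: valid_outcome_def)

lemma offline_opt_le:
  assumes "\<And>x. valid_outcome I x \<Longrightarrow> profit I x \<le> c"
  shows "offline_opt I \<le> c"
  unfolding offline_opt_def using assms valid_outcome_empty[of I] by (intro cSUP_least) auto

lemma profit_le_offline_opt:
  assumes "I \<in> instances" "valid_outcome I x"
  shows "profit I x \<le> offline_opt I"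
proof -
  \<comment> \<open>Taking \<open>X\<close> empty bounds every profit by the total work, so the
    supremum is over a bounded set.\<close>
  have "profit I y \<le> (\<Sum>i<length I. proc (I ! i))" if "valid_outcome I y" for y
    using profit_le[OF that, of "{}" "{}"] assms by simp
  then show ?thesis
    unfolding offline_opt_def using assms(2) by (intro cSUP_upper bdd_aboveI2) auto
qed

section \<open>Completed value, work and shortage of a plan\<close>

definition completed :: "job list \<Rightarrow> nat set \<Rightarrow> plan \<Rightarrow> nat set" where
  "completed I A P = {i \<in> A. proc (I ! i) \<le> planned_work P i}"

definition work :: "job list \<Rightarrow> nat set \<Rightarrow> real" where
  "work I X = (\<Sum>i\<in>X. proc (I ! i))"

definition shortage :: "job list \<Rightarrow> nat set \<Rightarrow> plan \<Rightarrow> real" where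
  "shortage I A P = (\<Sum>i\<in>A. planned_shortage I P i)"

lemma work_mono: 
  assumes "I \<in> instances" "X \<subseteq> Y" "Y \<subseteq> {..<length I}"
  shows "work I X \<le> work I Y"
  unfolding work_def
proof (rule sum_mono2)
  show "finite Y" using assms(3) finite_subset by blast
  show "0 \<le> proc (I ! i)" if "i \<in> Y - X" for i
    using instances_job(1)[OF assms(1), of i] assms(3) that by auto
qed (fact assms(2))

text \<open>Completed jobs have shortage 0 under an admissible plan, so the shortage may be summed
  over all accepted jobs.\<close>

lemma profit_plan:
  assumes "admissible I n A P"
  shows "profit I (A, plan_schedule P) = work I (completed I A P) - shortage I A P"
proof -
  have fin: "finite A" using assms finite_subset by (auto simp: admissible_def)
  have "profit I (A, plan_schedule P) = (\<Sum>i\<in>A. (if i \<in> completed I A P then proc (I ! i) else 0) - planned_shortage I P i)"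
    unfolding profit_def prod.case
  proof (rule sum.cong[OF refl])
    fix i assume "i \<in> A"
    then have "planned_work P i \<le> proc (I ! i)" "received (plan_schedule P) i = planned_work P i"
      using assms by (auto simp: admissible_def received_plan_schedule)
    then show "(if proc (I ! i) \<le> received (plan_schedule P) i then job_value (I ! i)
        else - (proc (I ! i) - received (plan_schedule P) i)) =
      (if i \<in> completed I A P then proc (I ! i) else 0) - planned_shortage I P i"
      using \<open>i \<in> A\<close> by (simp add: completed_def planned_shortage_def job_value_def)
  qed
  also have "\<dots> = work I (completed I A P) - shortage I A P"
    using fin by (simp add: sum_subtractf shortage_def work_def completed_def sum.If_cases Int_def)
  finally show ?thesis .
qed

section \<open>The charging argument\<close>

definition balanced :: "real \<Rightarrow> job list \<Rightarrow> nat set \<Rightarrow> plan \<Rightarrow> bool" where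
  "balanced \<beta> I A P \<longleftrightarrow>
     (\<beta> - 1) * work I (A - completed I A P) + shortage I A P \<le> work I (completed I A P)"

text \<open>
  The jobs that are lost so far, and the completed jobs that could be lost by accepting one of the
  declined jobs, have all their windows inside \<open>U1 \<union> U2\<close>.  The part of this set during which the
  plan is idle is paid for by the endangered jobs: \<open>U2\<close> and \<open>K2\<close> belong to the current busy period,
  which may still be extended or replanned, \<open>U1\<close> and \<open>K1\<close> to the earlier ones.
\<close>
inductive covered :: "real \<Rightarrow> job list \<Rightarrow> nat \<Rightarrow> nat set \<Rightarrow> plan \<Rightarrow> bool" for \<beta> I n A P where
  coveredI: "\<lbrakk>K1 \<union> K2 \<subseteq> completed I A P; K1 \<inter> K2 = {}; U1 \<in> lmeasurable; U2 \<in> lmeasurable;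
    \<And>i. i < n \<Longrightarrow> i \<notin> completed I A P - (K1 \<union> K2) \<Longrightarrow>
      {release (I ! i)..<deadline (I ! i)} \<subseteq> U1 \<union> U2;
    measure lebesgue (U1 - busy P) \<le> \<beta> * work I K1;
    \<And>i a b j. (i, a, b) \<in> set P \<Longrightarrow> i \<in> K1 \<Longrightarrow> n \<le> j \<Longrightarrow> j < length I \<Longrightarrow> b \<le> release (I ! j);
    U2 - busy P \<subseteq> {z..<z + \<beta> * work I K2};
    \<And>t. t < plan_end t P \<Longrightarrow> plan_end t P = z\<rbrakk> \<Longrightarrow> covered \<beta> I n A P"

lemma work_insert: "finite X \<Longrightarrow> i \<notin> X \<Longrightarrow> work I (insert i X) = proc (I ! i) + work I X"
  by (simp add: work_def)

lemma work_Un: "finite X \<Longrightarrow> finite Y \<Longrightarrow> X \<inter> Y = {} \<Longrightarrow> work I (X \<union> Y) = work I X + work I Y"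
  by (simp add: work_def sum.union_disjoint)

lemma work_Diff: "finite X \<Longrightarrow> Y \<subseteq> X \<Longrightarrow> work I (X - Y) = work I X - work I Y"
  by (simp add: work_def sum_diff)

lemma work_nonneg: "I \<in> instances \<Longrightarrow> X \<subseteq> {..<length I} \<Longrightarrow> 0 \<le> work I X"
  using work_mono[of I "{}" X] by (simp add: work_def)

section \<open>Invariants when the job is appended\<close>

context arrival
begin

lemma completed_subset: "completed I A P \<subseteq> A"
  by (auto simp: completed_def)

lemma finite_completed: "finite (completed I A P)"
  using completed_subset finite_jobs by (rule finite_subset)

lemma jobs_length: "A \<subseteq> {..<length I}"
  using job_less n_less by force

lemma completed_append:
  assumes "fin + pr \<le> dl"
  shows "completed I (insert n A) (P @ [(n, fin, fin + pr)]) = insert n (completed I A P)"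
  using new_job planned_work_new by (auto simp: completed_def pr_def)

lemma balanced_append:
  assumes "fin + pr \<le> dl" "balanced \<beta> I A P"
  shows "balanced \<beta> I (insert n A) (P @ [(n, fin, fin + pr)])"
proof -
  let ?Q = "P @ [(n, fin, fin + pr)]"
  have "shortage I (insert n A) ?Q = (\<Sum>i\<in>A. planned_shortage I ?Q i)"
    using finite_jobs new_job planned_work_new by (simp add: shortage_def planned_shortage_def pr_def)
  also have "\<dots> = shortage I A P"
    unfolding shortage_def using new_job by (intro sum.cong) (auto simp: planned_shortage_def)
  finally have "shortage I (insert n A) ?Q = shortage I A P" .
  moreover have "insert n A - insert n (completed I A P) = A - completed I A P"
    using new_job by auto
  moreover have "work I (insert n (completed I A P)) = pr + work I (completed I A P)"
    using finite_completed new_job completed_subset by (subst work_insert) (auto simp: pr_def)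
  ultimately show ?thesis
    using assms(2) pr_pos by (simp add: balanced_def completed_append[OF assms(1)])
qed

lemma covered_append:
  assumes "fin + pr \<le> dl" "covered \<beta> I n A P" "0 \<le> \<beta>"
  shows "covered \<beta> I (Suc n) (insert n A) (P @ [(n, fin, fin + pr)])"
proof -
  let ?Q = "P @ [(n, fin, fin + pr)]" and ?F = "completed I A P"
  obtain K1 K2 U1 U2 z where K: "K1 \<union> K2 \<subseteq> ?F" "K1 \<inter> K2 = {}"
    and U: "U1 \<in> lmeasurable" "U2 \<in> lmeasurable"
    and win: "\<And>i. i < n \<Longrightarrow> i \<notin> ?F - (K1 \<union> K2) \<Longrightarrow> {release (I ! i)..<deadline (I ! i)} \<subseteq> U1 \<union> U2"
    and U1: "measure lebesgue (U1 - busy P) \<le> \<beta> * work I K1"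
    and past: "\<And>i a b j. (i, a, b) \<in> set P \<Longrightarrow> i \<in> K1 \<Longrightarrow> n \<le> j \<Longrightarrow> j < length I \<Longrightarrow> b \<le> release (I ! j)"
    and U2: "U2 - busy P \<subseteq> {z..<z + \<beta> * work I K2}"
    and z: "\<And>t. t < plan_end t P \<Longrightarrow> plan_end t P = z"
    by (rule covered.cases[OF assms(2)]) (rule that; assumption)
  have finK: "finite K1" "finite K2"
    using K(1) finite_subset[OF _ finite_completed] by auto
  have nK: "n \<notin> K1" "n \<notin> K2" using K(1) completed_subset new_job by auto
  have F: "completed I (insert n A) ?Q = insert n ?F" by (rule completed_append[OF assms(1)])
  have K': "K1 \<union> K2 \<subseteq> completed I (insert n A) ?Q" using K(1) F by auto
  have win': "{release (I ! i)..<deadline (I ! i)} \<subseteq> U1 \<union> U2"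
    if "i < Suc n" "i \<notin> completed I (insert n A) ?Q - (K1 \<union> K2)" for i
    using that win[of i] nK by (cases "i = n") (auto simp: F)
  have end': "plan_end t ?Q = max t (fin + pr)" for t
    by (simp add: plan_end_def)
  have meas: "U - busy P \<in> lmeasurable" "U - busy ?Q \<in> lmeasurable" if "U \<in> lmeasurable" for U
    using that by (auto intro: fmeasurable.Diff simp del: busy_simps)
  have mono: "measure lebesgue (U - busy ?Q) \<le> measure lebesgue (U - busy P)" if "U \<in> lmeasurable" for U
    using meas[OF that] by (intro measure_mono_fmeasurable) (auto simp: fmeasurableD)
  show ?thesis
  proof (cases "fin = rel")
    case True
    \<comment> \<open>No planned work remains, so a busy period is over. Its account
      \<open>U2\<close>, \<open>K2\<close> is merged into \<open>U1\<close>, \<open>K1\<close>,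
      where a bound on the measure is enough.\<close>
    have "measure lebesgue (U2 - busy P) \<le> measure lebesgue {z..<z + \<beta> * work I K2}"
      using meas[OF U(2)] by (intro measure_mono_fmeasurable[OF U2]) (auto simp: fmeasurableD)
    also have "\<dots> = \<beta> * work I K2"
    proof -
      have "K2 \<subseteq> {..<length I}" using K(1) completed_subset jobs_length by blast
      then show ?thesis using assms(3) work_nonneg[OF inst, of K2] by simp
    qed
    finally have "measure lebesgue (U1 - busy ?Q) + measure lebesgue (U2 - busy ?Q) \<le> \<beta> * work I (K1 \<union> K2)"
      using U1 mono[OF U(1)] mono[OF U(2)] finK K(2) by (simp add: work_Un distrib_left)
    then have "measure lebesgue (U1 \<union> U2 - busy ?Q) \<le> \<beta> * work I (K1 \<union> K2)"
      using measure_Un_le[of "U1 - busy ?Q" lebesgue "U2 - busy ?Q"] meas[OF U(1)] meas[OF U(2)]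
      by (simp add: Un_Diff fmeasurableD del: busy_simps)
    moreover have "b \<le> release (I ! j)"
      if "(i, a, b) \<in> set ?Q" "i \<in> K1 \<union> K2" "Suc n \<le> j" "j < length I" for i a b j
    proof -
      have "(i, a, b) \<in> set P" using that nK by auto
      then have "b \<le> rel" using piece_le_fin True by auto
      also have "rel \<le> release (I ! j)" unfolding rel_def using that instances_release_mono[OF inst] by simp
      finally show ?thesis .
    qed
    ultimately show ?thesis
      using K' win' fmeasurable.Un[OF U] end'
      by (intro coveredI[of "K1 \<union> K2" "{}" _ _ _ "U1 \<union> U2" "{}" _ _ "fin + pr"]) (simp_all add: max_def split: if_splits)
  next
    case False
    then have "fin = z" using z[of rel] rel_le_fin by (auto simp: fin_def)
    \<comment> \<open>The busy period continues. Its end moves by \<open>pr\<close>, and the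
      appended piece makes the first \<open>pr\<close> units after \<open>fin\<close> busy, so the
      interval holding the idle time can be shifted along.\<close>
    have "U2 - busy ?Q \<subseteq> {fin + pr..<(fin + pr) + \<beta> * work I K2}"
    proof (intro subsetI)
      fix t assume "t \<in> U2 - busy ?Q"
      then have "t \<in> U2 - busy P" "t \<notin> {fin..<fin + pr}" by auto
      then show "t \<in> {fin + pr..<(fin + pr) + \<beta> * work I K2}"
        using subsetD[OF U2, of t] \<open>fin = z\<close> pr_pos by auto
    qed
    moreover have "b \<le> release (I ! j)"
      if "(i, a, b) \<in> set ?Q" "i \<in> K1" "Suc n \<le> j" "j < length I" for i a b j
      using that nK past[of i a b j] by auto
    moreover have "measure lebesgue (U1 - busy ?Q) \<le> \<beta> * work I K1"
      using U1 mono[OF U(1)] by linarith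
    ultimately show ?thesis
      using K' K(2) win' U end'
      by (intro coveredI[of K1 K2 _ _ _ U1 U2 _ _ "fin + pr"]) (assumption | simp add: max_def split: if_splits)+
  qed
qed

end

section \<open>Invariants when the job is inserted or declined\<close>

context overload
begin

lemma spoiled_subset: "spoiled \<subseteq> completed I A P"
  by (auto simp: spoiled_def completed_def affected_def)

lemma completed_new_plan:
  "completed I (insert n A) new_plan = insert n (completed I A P - spoiled)"
proof (intro set_eqI)
  fix i
  consider "i = n" | "i \<in> A" "i \<noteq> n" | "i \<notin> insert n A" by blast
  then show "i \<in> completed I (insert n A) new_plan \<longleftrightarrow> i \<in> insert n (completed I A P - spoiled)"
  proof cases
    case 1
    then show ?thesis by (simp add: completed_def planned_work_new_plan_new pr_def)
  next
    case 2
    have "planned_work new_plan i \<le> planned_work P i"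
      using planned_work_new_plan_old[OF 2(1)] planned_work_laid_le[of i] by simp
    then show ?thesis
      using 2 planned_work_le[OF 2(1)] by (auto simp: completed_def spoiled_def affected_def)
  qed (auto simp: completed_def)
qed

text \<open>With \<open>V = work I spoiled\<close>, insertion changes \<open>C\<close> by
  \<open>pr - V\<close>, \<open>B\<close> by \<open>V\<close> and \<open>H\<close> by
  \<open>pr - (new_end - fin)\<close>. The inequality survives as soon as
  \<open>\<beta> * V \<le> new_end - fin\<close>, which the acceptance test provides.\<close>

lemma balanced_new_plan:
  assumes "new_end - fin > \<beta> * work I spoiled" "balanced \<beta> I A P"
  shows "balanced \<beta> I (insert n A) new_plan"
proof -
  have fin: "finite spoiled" using spoiled_subset finite_completed by (rule finite_subset)
  have "shortage I (insert n A) new_plan = (\<Sum>i\<in>A. planned_shortage I new_plan i)"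
    using finite_jobs new_job by (simp add: shortage_def planned_shortage_def planned_work_new_plan_new pr_def)
  also have "\<dots> = shortage I A P + (\<Sum>i\<in>A. planned_work P i - planned_work new_plan i)"
    by (simp add: shortage_def planned_shortage_def sum.distrib[symmetric])
  finally have S: "shortage I (insert n A) new_plan = shortage I A P + (fin + pr - new_end)"
    by (simp add: sum_lost)
  have "insert n A - insert n (completed I A P - spoiled) = (A - completed I A P) \<union> spoiled"
    using new_job spoiled_subset completed_subset by auto
  then have B: "work I (insert n A - insert n (completed I A P - spoiled)) =
      work I (A - completed I A P) + work I spoiled"
    using spoiled_subset fin finite_jobs work_Un[of "A - completed I A P" spoiled I] by auto
  have C: "work I (insert n (completed I A P - spoiled)) = pr + (work I (completed I A P) - work I spoiled)"
    using finite_completed new_job completed_subset spoiled_subset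
    by (subst work_insert) (auto simp: pr_def work_Diff)
  show ?thesis
    using assms unfolding balanced_def completed_new_plan S B C by (simp add: algebra_simps)
qed

lemma spoiled_window:
  assumes "i \<in> spoiled"
  shows "{release (I ! i)..<deadline (I ! i)} \<subseteq> busy P \<union> {fin..<new_end}"
    and "\<exists>a b. (i, a, b) \<in> set P \<and> rel < b"
  using affected_window[of i] assms rel_le_cut unfolding spoiled_def by fastforce+

lemma covered_step:
  assumes "covered \<beta> I n A P" "0 \<le> \<beta>"
  shows "new_end - fin > \<beta> * work I spoiled \<Longrightarrow> covered \<beta> I (Suc n) (insert n A) new_plan"
    and "\<not> new_end - fin > \<beta> * work I spoiled \<Longrightarrow> covered \<beta> I (Suc n) A P"
proof -
  let ?F = "completed I A P" and ?W = "\<lambda>i. {release (I ! i)..<deadline (I ! i)}"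
  obtain K1 K2 U1 U2 z where K: "K1 \<union> K2 \<subseteq> ?F" "K1 \<inter> K2 = {}"
    and U: "U1 \<in> lmeasurable" "U2 \<in> lmeasurable"
    and win: "\<And>i. i < n \<Longrightarrow> i \<notin> ?F - (K1 \<union> K2) \<Longrightarrow> ?W i \<subseteq> U1 \<union> U2"
    and U1: "measure lebesgue (U1 - busy P) \<le> \<beta> * work I K1"
    and past: "\<And>i a b j. (i, a, b) \<in> set P \<Longrightarrow> i \<in> K1 \<Longrightarrow> n \<le> j \<Longrightarrow> j < length I \<Longrightarrow> b \<le> release (I ! j)"
    and U2: "U2 - busy P \<subseteq> {z..<z + \<beta> * work I K2}"
    and z: "\<And>t. t < plan_end t P \<Longrightarrow> plan_end t P = z"
    by (rule covered.cases[OF assms(1)]) (rule that; assumption)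
  have "fin = z" using z[of rel] rel_less_fin by (auto simp: fin_def)
  note U2 = U2[folded this]
  have finK: "finite K1" "finite K2" "finite spoiled"
    using K(1) spoiled_subset finite_subset[OF _ finite_completed] by auto
  \<comment> \<open>A spoiled job has a piece ending after \<open>rel\<close>, whereas the pieces of
    jobs in closed accounts end by every coming release, that of job \<open>n\<close>
    included.\<close>
  have K1_spoiled: "K1 \<inter> spoiled = {}"
  proof (intro equals0I)
    fix i assume "i \<in> K1 \<inter> spoiled"
    moreover from this obtain a b where "(i, a, b) \<in> set P" "rel < b" using spoiled_window(2) by blast
    ultimately show False using past[of i a b n] n_less by (auto simp: rel_def)
  qed
  have finite_union: "U2 \<union> (\<Union>i\<in>X. ?W i) \<in> lmeasurable" if "finite X" for X
    using that by (intro fmeasurable.Un U fmeasurable.finite_UN) auto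
  {
    assume acc: "new_end - fin > \<beta> * work I spoiled"
    have nK: "n \<notin> K1 \<union> K2" using K(1) completed_subset new_job by auto
    \<comment> \<open>On acceptance, spoiled jobs leave \<open>K2\<close>: the end of the plan moves
      by more than \<open>\<beta> * work I spoiled\<close>, which makes up for their share of the
      interval.\<close>
    have "\<beta> * work I K2 \<le> \<beta> * work I ((K2 - spoiled) \<union> spoiled)"
      using assms(2) K(1) spoiled_subset completed_subset jobs_length
      by (intro mult_left_mono work_mono[OF inst]) auto
    also have "\<dots> = \<beta> * work I (K2 - spoiled) + \<beta> * work I spoiled"
      using finK by (subst work_Un) (auto simp: distrib_left)
    finally have ext: "fin + \<beta> * work I K2 \<le> new_end + \<beta> * work I (K2 - spoiled)"
      using acc by linarith
    \<comment> \<open>Windows of spoiled jobs lie in \<open>busy P\<close> and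
      \<open>{fin..<new_end}\<close>, both busy under \<open>new_plan\<close>, so the only idle time
      left is old idle time of \<open>U2\<close> beyond \<open>new_end\<close>.\<close>
    then have idle: "(U2 \<union> (\<Union>i\<in>spoiled. ?W i)) - busy new_plan \<subseteq> {new_end..<new_end + \<beta> * work I (K2 - spoiled)}"
    proof (intro subsetI)
      fix t assume t: "t \<in> (U2 \<union> (\<Union>i\<in>spoiled. ?W i)) - busy new_plan"
      then have "t \<notin> busy P" "t < rel \<or> new_end \<le> t" by (auto simp: busy_new_plan)
      moreover have "t \<in> U2 - busy P \<or> t \<in> {fin..<new_end}"
        using t spoiled_window(1) \<open>t \<notin> busy P\<close> by blast
      ultimately have "t \<in> U2 - busy P" "new_end \<le> t"
        using U2 rel_le_fin by auto
      then show "t \<in> {new_end..<new_end + \<beta> * work I (K2 - spoiled)}"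
        using subsetD[OF U2] ext by fastforce
    qed
    have "measure lebesgue (U1 - busy new_plan) \<le> measure lebesgue (U1 - busy P)"
    proof (rule measure_mono_fmeasurable)
      show "U1 - busy new_plan \<subseteq> U1 - busy P" unfolding busy_new_plan by blast
    qed (intro fmeasurableD fmeasurable.Diff U(1) lmeasurable_busy)+
    then have U1': "measure lebesgue (U1 - busy new_plan) \<le> \<beta> * work I K1" using U1 by linarith
    have past': "b \<le> release (I ! j)"
      if "(i, a, b) \<in> set new_plan" "i \<in> K1" "Suc n \<le> j" "j < length I" for i a b j
    proof -
      have old: "b' \<le> rel" if "(i, a', b') \<in> set P" for a' b'
        using past[OF that \<open>i \<in> K1\<close> order_refl n_less] by (simp add: rel_def)
      have "i \<noteq> n" using nK \<open>i \<in> K1\<close> by auto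
      then consider b' where "(i, a, b') \<in> set P" "b \<le> b'" | a' where "(i, a', b) \<in> set P"
        | "(i, a, b) \<in> set laid"
        using \<open>(i, a, b) \<in> set new_plan\<close> by (auto simp: new_plan_def set_plan_before set_plan_after)
      then have "b \<le> rel"
      proof cases
        \<comment> \<open>This case is contradictory: a job that is laid out again has an old piece
          ending after \<open>cut\<close>, but the old pieces of a job in \<open>K1\<close> end by
          \<open>rel \<le> cut\<close>.\<close>
        case 3
        then have "i \<in> fst ` set moved" using laid_jobs by force
        then obtain a' b' where "(i, a', b') \<in> set moved" by auto
        then obtain a'' b'' where "(i, a'', b'') \<in> set P" "cut < b''" by (rule moved_piece)
        then show ?thesis using old rel_le_cut by fastforce
      qed (use old in force)+
      also have "rel \<le> release (I ! j)" unfolding rel_def using that instances_release_mono[OF inst] by simp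
      finally show ?thesis .
    qed
    have win': "?W i \<subseteq> U1 \<union> (U2 \<union> (\<Union>i\<in>spoiled. ?W i))"
      if "i < Suc n" "i \<notin> insert n (?F - spoiled) - (K1 \<union> (K2 - spoiled))" for i
    proof (cases "i \<in> spoiled")
      case False
      then have "i < n" "i \<notin> ?F - (K1 \<union> K2)" using that nK by (auto simp: less_Suc_eq)
      then show ?thesis using win by blast
    qed blast
    show "covered \<beta> I (Suc n) (insert n A) new_plan"
    proof (rule coveredI[OF _ _ U(1) finite_union[OF finK(3)] _ U1' _ idle])
      show "K1 \<union> (K2 - spoiled) \<subseteq> completed I (insert n A) new_plan" "K1 \<inter> (K2 - spoiled) = {}"
        using K K1_spoiled by (auto simp: completed_new_plan)
      show "plan_end t new_plan = new_end" if "t < plan_end t new_plan" for t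
        using that plan_end_new_plan[OF chrono_new_plan, of t] by (simp add: max_def split: if_splits)
    qed (use win' past' in \<open>simp_all add: completed_new_plan\<close>)
  next
    assume dec: "\<not> new_end - fin > \<beta> * work I spoiled"
    let ?X = "insert n spoiled"
    \<comment> \<open>On a decline, \<open>spoiled\<close> joins \<open>K2\<close>, and the two may
      overlap. As the old and the new idle time both sit in intervals starting at
      \<open>fin\<close>, only the longer interval counts and no job pays twice.\<close>
    have "\<beta> * work I spoiled \<le> \<beta> * work I (K2 \<union> spoiled)" "\<beta> * work I K2 \<le> \<beta> * work I (K2 \<union> spoiled)"
      using assms(2) K(1) spoiled_subset completed_subset jobs_length
      by (intro mult_left_mono work_mono[OF inst]; auto)+
    then have le: "new_end \<le> fin + \<beta> * work I (K2 \<union> spoiled)" "\<beta> * work I K2 \<le> \<beta> * work I (K2 \<union> spoiled)"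
      using dec by linarith+
    have Wn: "?W n \<subseteq> busy P \<union> {fin..<new_end}"
      using busy_until_fin max_le_new_end(1) by (fastforce simp: rel_def[symmetric] dl_def[symmetric])
    have idle: "(U2 \<union> (\<Union>i\<in>?X. ?W i)) - busy P \<subseteq> {fin..<fin + \<beta> * work I (K2 \<union> spoiled)}"
    proof -
      have "(U2 \<union> (\<Union>i\<in>?X. ?W i)) - busy P \<subseteq> (U2 - busy P) \<union> {fin..<new_end}"
        using spoiled_window(1) Wn by blast
      moreover have "{fin..<new_end} \<subseteq> {fin..<fin + \<beta> * work I (K2 \<union> spoiled)}"
        "{fin..<fin + \<beta> * work I K2} \<subseteq> {fin..<fin + \<beta> * work I (K2 \<union> spoiled)}"
        using le by (simp_all add: ivl_subset)
      ultimately show ?thesis using U2 by blast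
    qed
    have past': "b \<le> release (I ! j)" 
      if "(i, a, b) \<in> set P" "i \<in> K1" "Suc n \<le> j" "j < length I" for i a b j
      using past[of i a b j] that by simp
    have win': "?W i \<subseteq> U1 \<union> (U2 \<union> (\<Union>i\<in>?X. ?W i))"
      if "i < Suc n" "i \<notin> ?F - (K1 \<union> (K2 \<union> spoiled))" for i
    proof (cases "i \<in> ?X")
      case False
      then have "i < n" "i \<notin> ?F - (K1 \<union> K2)" using that by auto
      then show ?thesis using win by blast
    qed blast
    show "covered \<beta> I (Suc n) A P"
    proof (rule coveredI[OF _ _ U(1) finite_union _ U1 past' idle])
      show "K1 \<union> (K2 \<union> spoiled) \<subseteq> ?F" "K1 \<inter> (K2 \<union> spoiled) = {}"
        using K K1_spoiled spoiled_subset by auto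
      show "finite ?X" using finK(3) by simp
      show "plan_end t P = fin" if "t < plan_end t P" for t
        using that by (simp add: plan_end_fin max_def split: if_splits)
    qed (use win' in simp_all)
  }
qed

end

lemma invariants_dsc_state:
  assumes "I \<in> instances" "0 \<le> \<beta>" "n \<le> length I" "dsc_state \<beta> I n = (A, P)"
  shows "balanced \<beta> I A P \<and> covered \<beta> I n A P"
  using assms(3,4)
proof (induction n arbitrary: A P)
  case 0
  have "covered \<beta> I 0 {} []"
    by (rule coveredI[of "{}" "{}" _ _ _ "{}" "{}"]) (simp_all add: work_def plan_end_def)
  then show ?case using 0 by (simp add: balanced_def completed_def work_def shortage_def)
next
  case (Suc n)
  obtain A' P' where s: "dsc_state \<beta> I n = (A', P')" by fastforce
  have IH: "balanced \<beta> I A' P'" "covered \<beta> I n A' P'" using Suc s by auto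
  interpret arrival I n A' P'
    using Suc assms(1) s admissible_dsc_state by unfold_locales auto
  have step: "dsc_step \<beta> I n (A', P') = (A, P)" using Suc.prems s by simp
  show ?case
  proof (cases "fin + pr \<le> dl")
    case True
    then show ?thesis
      using step balanced_append[OF True IH(1)] covered_append[OF True IH(2) assms(2)]
      by (auto simp: dsc_step_append)
  next
    case False
    then interpret overload I n A' P' by (rule overload_intro)
    show ?thesis
      using step IH(1) balanced_new_plan[OF _ IH(1)] covered_step[OF IH(2) assms(2)]
      by (auto simp: dsc_step_insert work_def split: if_splits)
  qed
qed

text \<open>Completed jobs outside \<open>K1 \<union> K2\<close> are granted their full value. All
  other jobs share \<open>U1 \<union> U2\<close>, whose measure is at most the planned work plus
  \<open>\<beta> * k\<close>. Charging a job thus replaces its own value by \<open>\<beta>\<close>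
  times that value, so the bound is largest for \<open>k = C\<close>.\<close>

lemma offline_opt_le_profit:
  assumes "I \<in> instances" "admissible I (length I) A P" "balanced \<beta> I A P" "covered \<beta> I (length I) A P"
    and "1 \<le> \<beta>" "\<beta>\<^sup>2 = 2 * \<beta> + 1"
  shows "offline_opt I \<le> \<beta>\<^sup>2 * profit I (A, plan_schedule P)"
proof (rule offline_opt_le)
  fix x assume x: "valid_outcome I x"
  let ?F = "completed I A P"
  obtain K1 K2 U1 U2 z where K: "K1 \<union> K2 \<subseteq> ?F" "K1 \<inter> K2 = {}"
    and U: "U1 \<in> lmeasurable" "U2 \<in> lmeasurable"
    and win: "\<And>i. i < length I \<Longrightarrow> i \<notin> ?F - (K1 \<union> K2) \<Longrightarrow> {release (I ! i)..<deadline (I ! i)} \<subseteq> U1 \<union> U2"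
    and U1: "measure lebesgue (U1 - busy P) \<le> \<beta> * work I K1"
    and U2: "U2 - busy P \<subseteq> {z..<z + \<beta> * work I K2}"
    by (rule covered.cases[OF assms(4)]) (rule that; assumption)
  have A: "A \<subseteq> {..<length I}" and chrono: "chronological P" and jobs: "fst ` set P \<subseteq> A"
    and pw: "\<And>i. i \<in> A \<Longrightarrow> planned_work P i \<le> proc (I ! i)"
    using assms(2) by (auto simp: admissible_def)
  have FA: "?F \<subseteq> A" by (auto simp: completed_def)
  have fin: "finite A" "finite ?F" "finite K1" "finite K2"
  proof -
    show "finite A" using A by (rule finite_subset) simp
    then show "finite ?F" using FA by (rule finite_subset[rotated])
    then show "finite K1" "finite K2" using K(1) finite_subset[of _ ?F] by blast+
  qed
  have nonneg: "0 \<le> work I X" if "X \<subseteq> A" for X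
    using work_nonneg[OF assms(1)] that A by blast
  define C B H k where defs: "C = work I ?F" "B = work I (A - ?F)" "H = shortage I A P" "k = work I (K1 \<union> K2)"
  have k: "k = work I K1 + work I K2" using fin K(2) by (simp add: defs work_Un)
  have "0 \<le> k" "k \<le> C" "0 \<le> B"
    using nonneg[of "K1 \<union> K2"] nonneg[of "A - ?F"] work_mono[OF assms(1) K(1)] K(1) FA A
    by (auto simp: defs)
  have "H \<le> B"
  proof -
    have "H = (\<Sum>i\<in>A - ?F. planned_shortage I P i)"
      unfolding defs shortage_def
      by (rule sum.mono_neutral_right[OF fin(1)]) (use pw in \<open>force simp: completed_def planned_shortage_def\<close>)+
    also have "\<dots> \<le> B"
      unfolding defs work_def
      by (intro sum_mono) (simp add: planned_shortage_def planned_work_nonneg chrono)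
    finally show ?thesis .
  qed
  have "total_work P = C + B - H"
  proof -
    have "total_work P = (\<Sum>i\<in>A. planned_work P i)" using sum_planned_work[OF fin(1) jobs] by simp
    also have "\<dots> = work I A - H"
      by (simp add: defs shortage_def planned_shortage_def work_def sum_subtractf)
    also have "work I A = C + B" using work_Diff[OF fin(1) FA] by (simp add: defs)
    finally show ?thesis by simp
  qed
  moreover have "measure lebesgue (U1 \<union> U2) \<le> total_work P + \<beta> * work I K1 + \<beta> * work I K2"
  proof -
    have meas: "U1 - busy P \<in> lmeasurable" "U2 - busy P \<in> lmeasurable"
      using U by (auto intro: fmeasurable.Diff)
    note sets = meas[THEN fmeasurableD] lmeasurable_busy[of P, THEN fmeasurableD]
    have "measure lebesgue (U1 \<union> U2) \<le> measure lebesgue (busy P \<union> (U1 - busy P) \<union> (U2 - busy P))"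
    proof (rule measure_mono_fmeasurable)
      show "busy P \<union> (U1 - busy P) \<union> (U2 - busy P) \<in> lmeasurable"
        by (intro fmeasurable.Un meas lmeasurable_busy)
    qed (use fmeasurableD[OF fmeasurable.Un[OF U]] in blast)+
    also have "\<dots> \<le> measure lebesgue (busy P \<union> (U1 - busy P)) + measure lebesgue (U2 - busy P)"
      by (intro measure_Un_le sets.Un sets)
    also have "measure lebesgue (busy P \<union> (U1 - busy P)) \<le> measure lebesgue (busy P) + measure lebesgue (U1 - busy P)"
      by (intro measure_Un_le sets)
    also have "measure lebesgue (busy P) = total_work P" using chrono by (rule measure_busy)
    also have "measure lebesgue (U2 - busy P) \<le> measure lebesgue {z..<z + \<beta> * work I K2}"
      using meas by (intro measure_mono_fmeasurable[OF U2]) (auto simp: fmeasurableD)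
    also have "\<dots> = \<beta> * work I K2" 
    proof -
      have "K2 \<subseteq> A" using K(1) FA by blast
      then show ?thesis using nonneg[of K2] assms(5) by simp
    qed
    finally show ?thesis using U1 by simp
  qed
  moreover have "profit I x \<le> (C - k) + measure lebesgue (U1 \<union> U2)"
  proof -
    have "{..<length I} - ({..<length I} - (?F - (K1 \<union> K2))) = ?F - (K1 \<union> K2)" using FA A by auto
    then show ?thesis
      using profit_le[OF x, of "{..<length I} - (?F - (K1 \<union> K2))" "U1 \<union> U2"] U win assms(1)
        work_Diff[OF fin(2) K(1), of I]
      by (simp add: defs work_def fmeasurable.Un)
  qed
  ultimately have "profit I x \<le> 2 * C + B - H + (\<beta> - 1) * k"
    by (simp add: k algebra_simps)
  also have "\<dots> \<le> 2 * C + B - H + (\<beta> - 1) * C"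
    using \<open>k \<le> C\<close> assms(5) by (simp add: mult_left_mono)
  also have "\<dots> \<le> (2 * \<beta> + 1) * (C - H)"
  proof -
    \<comment> \<open>What has to be shown amounts to
      \<open>B + 2 * \<beta> * H \<le> \<beta> * C\<close>. Multiplying the balance by
      \<open>\<beta>\<close> gives \<open>B\<close> the coefficient
      \<open>\<beta>^2 - \<beta> = \<beta> + 1\<close>, and the part \<open>\<beta> * B\<close> of
      it pays for the second \<open>\<beta> * H\<close>.\<close>
    have "(\<beta> - 1) * B + H \<le> C" using assms(3) by (simp add: balanced_def defs)
    then have "\<beta> * ((\<beta> - 1) * B + H) \<le> \<beta> * C" using assms(5) by (intro mult_left_mono) auto
    moreover have "\<beta> * ((\<beta> - 1) * B + H) = (\<beta> + 1) * B + \<beta> * H"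
      using assms(6) by (simp add: algebra_simps power2_eq_square)
    moreover have "\<beta> * H \<le> \<beta> * B" using \<open>H \<le> B\<close> assms(5) by simp
    ultimately show ?thesis by (simp add: algebra_simps)
  qed
  also have "\<dots> = \<beta>\<^sup>2 * profit I (A, plan_schedule P)"
    using profit_plan[OF assms(2)] by (simp add: assms(6) defs)
  finally show "profit I x \<le> \<beta>\<^sup>2 * profit I (A, plan_schedule P)" .
qed

lemma competitive_dsc: "competitive (3 - 2 * sqrt 2) (dsc (1 + sqrt 2)) instances"
  unfolding competitive_def
proof (intro ballI impI)
  fix I assume I: "I \<in> instances" "0 < offline_opt I"
  define \<beta> :: real where "\<beta> = 1 + sqrt 2"
  obtain A P where s: "dsc_state \<beta> I (length I) = (A, P)" by fastforce
  have \<beta>: "1 \<le> \<beta>" "\<beta>\<^sup>2 = 2 * \<beta> + 1" by (simp_all add: \<beta>_def power2_eq_square algebra_simps)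
  have inv: "(3 - 2 * sqrt 2) * \<beta>\<^sup>2 = 1" by (simp add: \<beta>_def power2_eq_square algebra_simps)
  have "sqrt 2 \<le> 3 / 2" by (rule real_le_lsqrt) (simp_all add: power2_eq_square)
  then have "0 \<le> 3 - 2 * sqrt (2::real)" by simp
  have "offline_opt I \<le> \<beta>\<^sup>2 * profit I (A, plan_schedule P)"
    using offline_opt_le_profit[OF I(1) admissible_dsc_state[OF I(1) order_refl s]]
      invariants_dsc_state[OF I(1) _ order_refl s] \<beta> by simp
  then have "(3 - 2 * sqrt 2) * offline_opt I \<le> (3 - 2 * sqrt 2) * (\<beta>\<^sup>2 * profit I (A, plan_schedule P))"
    using \<open>0 \<le> 3 - 2 * sqrt 2\<close> by (rule mult_left_mono)
  also have "\<dots> = profit I (A, plan_schedule P)" using inv by (simp only: mult.assoc[symmetric] mult_1)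
  also have "\<dots> = profit I (dsc (1 + sqrt 2) I)" using dsc_eq[OF s] by (simp add: \<beta>_def)
  finally show "3 - 2 * sqrt 2 \<le> profit I (dsc (1 + sqrt 2) I) / offline_opt I"
    using I(2) by (simp add: le_divide_eq)
qed

section \<open>The adversary\<close>

text \<open>For the ratio r of a term to the sum of its predecessors, the recursion says that the
  next ratio is at most (r - 1) / (\<kappa> (r + 1)). This stays below r because the quadratic
  \<kappa> r^2 - (1 - \<kappa>) r + 1 has discriminant (1 - \<kappa>)^2 - 4 \<kappa>, which is
  negative for \<kappa> between 3 - 2 sqrt 2 and 1. So r drops by a fixed amount at each step and
  cannot stay positive.\<close>

lemma no_unbounded_growth:
  fixes x :: "nat \<Rightarrow> real" and \<kappa> :: real
  assumes pos: "\<And>m. 0 < x m" and \<kappa>: "3 - 2 * sqrt 2 < \<kappa>" "\<kappa> \<le> 1"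
    and step: "\<And>m. \<kappa> * x (Suc m) \<le> x m - (\<Sum>l<m. x l)"
  shows False
proof -
  define s where "s m = (\<Sum>l<m. x l)" for m
  \<comment> \<open>\<open>D\<close> is minus the discriminant. Asking for a drop by
    \<open>c\<close> raises the discriminant by at most \<open>2 * c + c + 4 * c\<close>, hence the
    7 in the next definition.\<close>
  define D where "D = 4 * \<kappa> - (1 - \<kappa>)\<^sup>2"
  define c where "c = D / 7"
  have "sqrt 2 \<le> 3 / 2" by (rule real_le_lsqrt) (simp_all add: power2_eq_square)
  then have "0 < \<kappa>" using \<kappa> by linarith
  \<comment> \<open>Used through the identity \<open>D = 8 - (3 - \<kappa>)^2\<close>.\<close>
  have "(3 - \<kappa>)\<^sup>2 < (2 * sqrt 2)\<^sup>2"
    using \<kappa> by (intro power_strict_mono) auto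
  then have "0 < D" by (simp add: D_def power2_eq_square algebra_simps)
  have "0 \<le> (1 - \<kappa>)\<^sup>2" by simp
  then have "D \<le> 4" using \<kappa>(2) unfolding D_def by linarith
  then have c: "0 < c" "c \<le> 1" using \<open>0 < D\<close> by (auto simp: c_def)
  have s_pos: "0 < s m" if "1 \<le> m" for m
    unfolding s_def using pos that by (intro sum_pos) (auto simp: lessThan_empty_iff)
  have decrease: "x (Suc m) / s (Suc m) \<le> x m / s m - c" if "1 \<le> m" for m
  proof -
    \<comment> \<open>In terms of r = \<open>x m / s m\<close>, the goal follows from \<kappa> r^2 -
      b r + (1 - c \<kappa>) \<ge> 0. The square is completed below after multiplying by
      \<open>4 * \<kappa>\<close> and by the square of \<open>s m\<close>.\<close>
    define b where "b = 1 - \<kappa> + c * \<kappa>"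
    have "2 * c * \<kappa> * (1 - \<kappa>) + c\<^sup>2 * \<kappa>\<^sup>2 + 4 * c * \<kappa>\<^sup>2 \<le> 7 * c"
    proof -
      have "\<kappa>\<^sup>2 \<le> 1" "c\<^sup>2 \<le> c" "\<kappa> * (1 - \<kappa>) \<le> 1"
        using \<kappa>(2) \<open>0 < \<kappa>\<close> c mult_le_one[of \<kappa> "1 - \<kappa>"] mult_left_le[of c c]
        by (auto simp: power2_eq_square mult_le_one)
      then have "c * (\<kappa> * (1 - \<kappa>)) \<le> c * 1" "c\<^sup>2 * \<kappa>\<^sup>2 \<le> c\<^sup>2 * 1" "c * \<kappa>\<^sup>2 \<le> c * 1"
        using c(1) by (intro mult_left_mono; simp)+
      then show ?thesis using \<open>c\<^sup>2 \<le> c\<close> by simp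
    qed
    moreover have "7 * c = 4 * \<kappa> - (1 - \<kappa>)\<^sup>2" by (simp add: c_def D_def)
    ultimately have "0 \<le> 4 * \<kappa> * (1 - c * \<kappa>) - b\<^sup>2"
      by (simp add: b_def power2_eq_square algebra_simps)
    then have "0 \<le> (2 * \<kappa> * x m - b * s m)\<^sup>2 + (4 * \<kappa> * (1 - c * \<kappa>) - b\<^sup>2) * (s m)\<^sup>2"
      by (intro add_nonneg_nonneg mult_nonneg_nonneg) auto
    also have "\<dots> = 4 * \<kappa> * (\<kappa> * ((x m - c * s m) * (s m + x m)) - (x m - s m) * s m)"
      by (simp add: b_def power2_eq_square algebra_simps)
    finally have "(x m - s m) * s m \<le> \<kappa> * ((x m - c * s m) * (s m + x m))"
      using \<open>0 < \<kappa>\<close> by (simp add: zero_le_mult_iff)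
    moreover have "\<kappa> * x (Suc m) * s m \<le> (x m - s m) * s m"
      using step[of m] s_pos[OF that] by (intro mult_right_mono) (auto simp: s_def)
    ultimately have "\<kappa> * (x (Suc m) * s m) \<le> \<kappa> * ((x m - c * s m) * (s m + x m))"
      by (simp add: mult.assoc)
    then have "x (Suc m) * s m \<le> (x m - c * s m) * (s m + x m)"
      using \<open>0 < \<kappa>\<close> by simp
    moreover have "s (Suc m) = s m + x m" by (simp add: s_def)
    ultimately show ?thesis
      using s_pos[OF that] pos[of m] by (simp add: field_simps)
  qed
  have "x (Suc m) / s (Suc m) \<le> x 1 / s 1 - c * m" for m
  proof (induction m)
    case (Suc m)
    then show ?case using decrease[of "Suc m"] by (simp add: algebra_simps)
  qed simp
  moreover have "0 < x (Suc m) / s (Suc m)" for m using pos s_pos[of "Suc m"] by simp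
  ultimately have bound: "c * real m < x 1 / s 1" for m by (smt (verit, best))
  obtain m where "x 1 / s 1 / c < real m" using reals_Archimedean2 by blast
  then have "x 1 / s 1 < real m * c" using c(1) by (simp only: pos_divide_less_eq)
  then show False using bound[of m] by (simp add: mult.commute)
qed

text \<open>\<open>A\<close> collects the accepted indices. It is infinite, since otherwise the
  right-hand sides stay bounded while \<open>q ^ Suc k\<close> grows. Applied to the
  \<open>k\<close> just before the next accepted index, the hypothesis becomes the recursion of
  \<open>no_unbounded_growth\<close> for the enumerated accepted sizes.\<close>

lemma no_acceptance_pattern:
  fixes A :: "nat set" and q \<kappa> :: real
  assumes "1 < q" "3 - 2 * sqrt 2 < \<kappa>" "\<kappa> \<le> 1"
    and latest: "\<And>k. \<exists>j\<in>A. j \<le> k \<and> (\<forall>i\<in>A. i \<le> k \<longrightarrow> i \<le> j) \<and>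
        \<kappa> * q ^ Suc k \<le> q ^ j - (\<Sum>i\<in>A \<inter> {..<j}. q ^ i)"
  shows False
proof -
  have "sqrt 2 \<le> 3 / 2" by (rule real_le_lsqrt) (simp_all add: power2_eq_square)
  then have "0 < \<kappa>" using assms(2) by linarith
  have "infinite A"
  proof
    assume "finite A"
    obtain N where N: "q ^ Max A / \<kappa> < q ^ N" using real_arch_pow[OF assms(1)] by blast
    obtain j where j: "j \<in> A" "\<kappa> * q ^ Suc N \<le> q ^ j - (\<Sum>i\<in>A \<inter> {..<j}. q ^ i)"
      using latest[of N] by blast
    have "\<kappa> * q ^ N \<le> \<kappa> * q ^ Suc N" using \<open>0 < \<kappa>\<close> assms(1) by simp
    also have "\<dots> \<le> q ^ j"
      using j(2) sum_nonneg[of "A \<inter> {..<j}" "\<lambda>i. q ^ i"] assms(1) by simp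
    also have "\<dots> \<le> q ^ Max A"
      using Max_ge[OF \<open>finite A\<close> j(1)] assms(1) by (intro power_increasing) auto
    finally show False using N \<open>0 < \<kappa>\<close> by (simp add: field_simps)
  qed
  define a where "a = enumerate A"
  have mono: "strict_mono a" and range: "range a = A"
    using \<open>infinite A\<close> by (auto simp: a_def strict_mono_enumerate range_enumerate)
  have less: "a l < a m \<longleftrightarrow> l < m" for l m using strict_mono_less[OF mono] .
  have "\<kappa> * q ^ a (Suc m) \<le> q ^ a m - (\<Sum>l<m. q ^ a l)" for m
  proof -
    have "0 < a (Suc m)" using less[of m "Suc m"] by simp
    then obtain k where k: "a (Suc m) = Suc k" using gr0_implies_Suc by blast
    obtain j where j: "j \<in> A" "j \<le> k" "\<And>i. i \<in> A \<Longrightarrow> i \<le> k \<Longrightarrow> i \<le> j"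
      and le: "\<kappa> * q ^ Suc k \<le> q ^ j - (\<Sum>i\<in>A \<inter> {..<j}. q ^ i)"
      using latest[of k] by blast
    have "a m \<le> j" using j(3)[of "a m"] less[of m "Suc m"] range k by auto
    moreover obtain l where "j = a l" using j(1) range by blast
    moreover have "l < Suc m" using less[of l "Suc m"] \<open>j = a l\<close> j(2) k by simp
    ultimately have "j = a m" using strict_mono_less_eq[OF mono] by (metis antisym less_Suc_eq_le)
    have "A \<inter> {..<a m} = a ` {..<m}" using range less by auto
    moreover have "inj_on a {..<m}" using strict_mono_imp_inj_on[OF mono] inj_on_subset by blast
    ultimately show ?thesis using le \<open>j = a m\<close> k by (simp add: sum.reindex)
  qed
  then show False
    using no_unbounded_growth[of "\<lambda>m. q ^ a m" \<kappa>] assms(1-3) by simp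
qed

text \<open>The releases increase strictly, so each prefix of the sequence is exactly what is known
  at some time, yet for positive \<open>\<delta>\<close> they all stay below
  \<open>\<delta>\<close>, while every size is at least 1.\<close>

definition tight_job :: "real \<Rightarrow> nat \<Rightarrow> job" where
  "tight_job \<delta> k = (let r = \<delta> * (1 - (1 / 2) ^ k); p = (1 + \<delta>) ^ k in
     \<lparr>release = r, proc = p, deadline = r + p\<rparr>)"

lemma tight_job_simps [simp]:
  "release (tight_job \<delta> k) = \<delta> * (1 - (1 / 2) ^ k)"
  "proc (tight_job \<delta> k) = (1 + \<delta>) ^ k"
  "deadline (tight_job \<delta> k) = \<delta> * (1 - (1 / 2) ^ k) + (1 + \<delta>) ^ k"
  by (simp_all add: tight_job_def Let_def)

locale adversary =
  fixes \<delta> :: real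
  assumes \<delta>: "0 < \<delta>" "\<delta> < 1 / 2"
begin

definition rel where "rel k = release (tight_job \<delta> k)"
definition siz where "siz k = (1 + \<delta>) ^ k"
definition inst where "inst n = map (tight_job \<delta>) [0..<n]"

lemma inst_simps [simp]:
  "length (inst n) = n"
  "i < n \<Longrightarrow> release (inst n ! i) = rel i"
  "i < n \<Longrightarrow> proc (inst n ! i) = siz i"
  "i < n \<Longrightarrow> deadline (inst n ! i) = rel i + siz i"
  by (simp_all add: inst_def rel_def siz_def)

lemma rel_less_iff: "rel i < rel j \<longleftrightarrow> i < j"
  using \<delta> by (simp add: rel_def power_strict_decreasing_iff)

lemma rel_le_iff: "rel i \<le> rel j \<longleftrightarrow> i \<le> j"
  using rel_less_iff by (meson not_le)

lemma rel_bounds: "0 \<le> rel i" "rel i \<le> \<delta>"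
  using \<delta> by (simp_all add: rel_def power_le_one mult_left_le)

lemma siz_ge_1: "1 \<le> siz i"
  using \<delta> by (simp add: siz_def)

lemma siz_mono: "i \<le> j \<Longrightarrow> siz i \<le> siz j"
  using \<delta> by (simp add: siz_def power_increasing)

lemma inst_instances: "inst n \<in> instances"
proof -
  have "sorted (map release (inst n))"
    by (simp add: sorted_iff_nth_mono rel_le_iff)
  moreover have "0 < proc T \<and> release T + proc T \<le> deadline T" if "T \<in> set (inst n)" for T
    using that \<delta> by (auto simp: inst_def)
  ultimately show ?thesis by (simp add: instances_def)
qed

lemma released_by_inst:
  assumes "i < n"
  shows "released_by (rel i) (inst n) = inst (Suc i)"
proof -
  have "released_by (rel i) (inst n) = map (tight_job \<delta>) (filter (\<lambda>j. j \<le> i) [0..<n])"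
    by (simp add: released_by_def inst_def filter_map comp_def rel_def[symmetric] rel_le_iff
        del: tight_job_simps)
  also have "[0..<n] = [0..<Suc i] @ [Suc i..<n]"
    using assms upt_add_eq_append[of 0 "Suc i" "n - Suc i"] by simp
  also have "filter (\<lambda>j. j \<le> i) ([0..<Suc i] @ [Suc i..<n]) = [0..<Suc i]"
    by (auto simp: filter_empty_conv simp del: upt_Suc intro!: filter_True)
  finally show ?thesis by (simp add: inst_def)
qed

lemma offline_opt_inst: "siz k \<le> offline_opt (inst (Suc k))"
proof -
  define \<sigma> where "\<sigma> t = (if t \<in> {rel k..rel k + siz k} then Some k else None)" for t
  have set: "{t. \<sigma> t = Some i} = (if i = k then {rel k..rel k + siz k} else {})" for i
    by (auto simp: \<sigma>_def)
  have "valid_outcome (inst (Suc k)) ({k}, \<sigma>)"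
    using set by (auto simp: valid_outcome_def \<sigma>_def split: if_splits)
  moreover have "received \<sigma> k = siz k"
    using set[of k] siz_ge_1[of k] by (simp add: received_def)
  then have "profit (inst (Suc k)) ({k}, \<sigma>) = siz k"
    by (simp add: profit_def job_value_def)
  ultimately show ?thesis
    using profit_le_offline_opt[OF inst_instances, of "Suc k" "({k}, \<sigma>)"] by simp
qed

text \<open>If \<open>j\<close> is completed, the accepted jobs before it receive at most
  \<open>\<delta>\<close> altogether, and an accepted job after it would lose at least
  \<open>siz j - \<delta>\<close>, cancelling the value of \<open>j\<close>. A profit above
  \<open>\<delta>\<close> therefore makes the completed job the last accepted one, with nearly all
  earlier accepted work lost.\<close>

lemma profit_inst:
  assumes valid: "valid_outcome (inst n) (A, \<sigma>)" and large: "\<delta> < profit (inst n) (A, \<sigma>)"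
  shows "\<exists>j\<in>A. (\<forall>i\<in>A. i \<le> j) \<and> profit (inst n) (A, \<sigma>) \<le> siz j - (\<Sum>i\<in>A \<inter> {..<j}. siz i) + \<delta>"
proof -
  define g where "g i = (if siz i \<le> received \<sigma> i then siz i else - (siz i - received \<sigma> i))" for i
  have A: "A \<subseteq> {..<n}" and meas: "\<And>i. {t. \<sigma> t = Some i} \<in> sets lebesgue"
    and win: "\<And>t i. \<sigma> t = Some i \<Longrightarrow> i \<in> A \<and> rel i \<le> t \<and> t \<le> rel i + siz i"
    using valid by (fastforce simp: valid_outcome_def)+
  have fin: "finite A" using A by (rule finite_subset) simp
  have profit: "profit (inst n) (A, \<sigma>) = (\<Sum>i\<in>A. g i)"
    unfolding profit_def prod.case g_def job_value_def
    by (rule sum.cong[OF refl]) (use A in auto)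
  have received_le: "(\<Sum>i\<in>X. received \<sigma> i) \<le> u - l"
    if "X \<subseteq> A" "\<And>i. i \<in> X \<Longrightarrow> l \<le> rel i \<and> rel i + siz i \<le> u" "l \<le> u" for X l u
  proof -
    have "finite X" using that(1) fin by (rule finite_subset)
    then have "(\<Sum>i\<in>X. received \<sigma> i) \<le> measure lebesgue {l..u}"
      by (rule measure_disjoint_windows[where N = "{}"])
        (use meas win that(2) in \<open>fastforce+\<close>)
    then show ?thesis using that(3) by simp
  qed
  have "\<exists>j\<in>A. 0 < g j"
  proof (rule ccontr)
    assume "\<not> ?thesis"
    then have "(\<Sum>i\<in>A. g i) \<le> 0" by (intro sum_nonpos) (auto simp: not_less)
    then show False using large profit \<delta> by simp
  qed
  then obtain j where j: "j \<in> A" "0 < g j" by blast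
  have full: "siz j \<le> received \<sigma> j" and gj: "g j = siz j"
    using j(2) by (auto simp: g_def split: if_splits)
  have before: "(\<Sum>i\<in>A \<inter> {..<j}. received \<sigma> i) \<le> \<delta>"
  proof -
    \<comment> \<open>All these windows lie between 0 and the deadline of \<open>j\<close>, and
      \<open>j\<close> itself takes \<open>siz j\<close> of that time, leaving at most
      \<open>rel j \<le> \<delta>\<close>.\<close>
    have "(\<Sum>i\<in>insert j (A \<inter> {..<j}). received \<sigma> i) \<le> (rel j + siz j) - 0"
    proof (rule received_le)
      fix i assume "i \<in> insert j (A \<inter> {..<j})"
      then have "i \<le> j" by auto
      then show "0 \<le> rel i \<and> rel i + siz i \<le> rel j + siz j"
        using rel_bounds siz_mono rel_le_iff by (auto intro: add_mono)
    qed (use j(1) rel_bounds(1)[of j] siz_ge_1[of j] in auto)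
    then show ?thesis using full fin rel_bounds(2)[of j] by simp
  qed
  have g_before: "g i = received \<sigma> i - siz i" if "i \<in> A" "i < j" for i
  proof -
    have "received \<sigma> i \<le> (\<Sum>i\<in>A \<inter> {..<j}. received \<sigma> i)"
      using that fin by (intro member_le_sum) (auto simp: received_def)
    then show ?thesis using before \<delta> siz_ge_1[of i] by (simp add: g_def)
  qed
  have g_after: "g i \<le> \<delta> - siz j" if "i \<in> A" "j < i" for i
  proof -
    have "(\<Sum>l\<in>{j, i}. received \<sigma> l) \<le> (rel i + siz i) - rel j"
    proof (rule received_le)
      fix l assume "l \<in> {j, i}"
      then show "rel j \<le> rel l \<and> rel l + siz l \<le> rel i + siz i"
        using that rel_le_iff siz_mono[of j i] by (auto intro: add_mono)
    qed (use that j(1) rel_le_iff[of j i] siz_ge_1[of i] in auto)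
    then have "received \<sigma> i \<le> siz i - siz j + \<delta>"
      using that full rel_bounds[of i] rel_bounds[of j] by simp
    then show ?thesis using \<delta> siz_ge_1[of j] by (simp add: g_def)
  qed
  have neg: "g i \<le> 0" if "i \<in> A" "i \<noteq> j" for i
  proof (cases "i < j")
    case True
    have "received \<sigma> i \<le> (\<Sum>i\<in>A \<inter> {..<j}. received \<sigma> i)"
      using that True fin by (intro member_le_sum) (auto simp: received_def)
    then show ?thesis using g_before[OF that(1) True] before \<delta> siz_ge_1[of i] by simp
  next
    case False
    then show ?thesis using g_after[OF that(1)] that(2) \<delta> siz_ge_1[of j] by simp
  qed
  have split: "(\<Sum>i\<in>A. g i) = siz j + (\<Sum>i\<in>A - {j}. g i)"
    using sum.remove[OF fin j(1), of g] gj by simp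
  have last: "i \<le> j" if "i \<in> A" for i
  proof (rule ccontr)
    assume "\<not> i \<le> j"
    then have i: "i \<in> A - {j}" "j < i" using that by auto
    have "(\<Sum>i\<in>A - {j}. g i) = g i + (\<Sum>i\<in>A - {j} - {i}. g i)"
      using fin i(1) by (intro sum.remove) auto
    moreover have "(\<Sum>i\<in>A - {j} - {i}. g i) \<le> 0" using neg by (intro sum_nonpos) auto
    ultimately show False using g_after[OF that i(2)] split large profit by simp
  qed
  have "A - {j} = A \<inter> {..<j}" using last by (auto simp: le_less)
  then have "(\<Sum>i\<in>A - {j}. g i) = (\<Sum>i\<in>A \<inter> {..<j}. received \<sigma> i) - (\<Sum>i\<in>A \<inter> {..<j}. siz i)"
    using g_before by (simp add: sum_subtractf)
  then show ?thesis using split before profit last j(1) by (intro bexI[of _ j]) auto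
qed

text \<open>The margin \<open>2 * \<delta>\<close> is spent in two halves: one passes from
  \<open>siz k\<close> to \<open>siz (Suc k)\<close>, using \<open>\<kappa> \<le> 1\<close>, and the
  other absorbs the additive error \<open>\<delta>\<close> of \<open>profit_inst\<close>, as sizes
  are at least 1.\<close>

lemma competitive_le:
  assumes S: "online_scheduler S" "competitive \<alpha> S instances" and \<kappa>: "3 - 2 * sqrt 2 < \<kappa>" "\<kappa> \<le> 1"
    and \<alpha>: "\<kappa> + 2 * \<delta> \<le> \<alpha>"
  shows False
proof -
  \<comment> \<open>The decision on job \<open>i\<close> is fixed when the instance has revealed
    just the jobs up to \<open>i\<close>, so one set describes the admissions in all instances
    \<open>inst n\<close>.\<close>
  define A where "A = {i. i \<in> fst (S (inst (Suc i)))}"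
  have "sqrt 2 \<le> 3 / 2" by (rule real_le_lsqrt) (simp_all add: power2_eq_square)
  then have "0 < \<kappa>" using \<kappa>(1) by linarith
  have valid: "valid_outcome (inst n) (S (inst n))" for n
    using S(1) inst_instances by (simp add: online_scheduler_def)
  have accepted: "fst (S (inst n)) = A \<inter> {..<n}" for n
  proof -
    have "i \<in> fst (S (inst n)) \<longleftrightarrow> i \<in> fst (S (inst (Suc i)))" if "i < n" for i
    proof -
      have "released_by (rel i) (inst n) = released_by (rel i) (inst (Suc i))"
        using released_by_inst that by simp
      then have "\<forall>l<length (released_by (rel i) (inst n)). l \<in> fst (S (inst n)) \<longleftrightarrow> l \<in> fst (S (inst (Suc i)))"
        using S(1) inst_instances unfolding online_scheduler_def by blast
      then show ?thesis using released_by_inst[OF that] by simp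
    qed
    moreover have "fst (S (inst n)) \<subseteq> {..<n}"
      using valid[of n] by (auto simp: valid_outcome_def split: prod.splits)
    ultimately show ?thesis by (auto simp: A_def)
  qed
  have "\<exists>j\<in>A. j \<le> k \<and> (\<forall>i\<in>A. i \<le> k \<longrightarrow> i \<le> j) \<and>
      \<kappa> * (1 + \<delta>) ^ Suc k \<le> (1 + \<delta>) ^ j - (\<Sum>i\<in>A \<inter> {..<j}. (1 + \<delta>) ^ i)" for k
  proof -
    let ?I = "inst (Suc k)"
    obtain \<sigma> where x: "S ?I = (A \<inter> {..<Suc k}, \<sigma>)" using accepted[of "Suc k"] by (metis prod.collapse)
    have opt: "siz k \<le> offline_opt ?I" by (rule offline_opt_inst)
    then have "\<alpha> * offline_opt ?I \<le> profit ?I (S ?I)"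
      using S(2) inst_instances siz_ge_1[of k] by (force simp: competitive_def le_divide_eq)
    moreover have "\<alpha> * siz k \<le> \<alpha> * offline_opt ?I"
      using opt \<alpha> \<open>0 < \<kappa>\<close> \<delta> by (intro mult_left_mono) auto
    moreover have "(\<kappa> + 2 * \<delta>) * siz k \<le> \<alpha> * siz k"
      using \<alpha> siz_ge_1[of k] by (intro mult_right_mono) auto
    ultimately have profit: "(\<kappa> + 2 * \<delta>) * siz k \<le> profit ?I (A \<inter> {..<Suc k}, \<sigma>)"
      unfolding x by linarith
    have \<delta>_siz: "\<delta> \<le> \<delta> * siz k" "0 < \<kappa> * siz k"
      using siz_ge_1[of k] \<delta> \<open>0 < \<kappa>\<close> by auto
    then have "\<delta> < profit ?I (A \<inter> {..<Suc k}, \<sigma>)" using profit \<delta>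
      unfolding distrib_right by linarith
    from profit_inst[OF valid[of "Suc k", unfolded x] this]
    obtain j where j: "j \<in> A" "j \<le> k" "\<And>i. i \<in> A \<Longrightarrow> i \<le> k \<Longrightarrow> i \<le> j"
      and le: "profit ?I (A \<inter> {..<Suc k}, \<sigma>) \<le> siz j - (\<Sum>i\<in>A \<inter> {..<Suc k} \<inter> {..<j}. siz i) + \<delta>"
      by (auto simp: less_Suc_eq_le)
    have "A \<inter> {..<Suc k} \<inter> {..<j} = A \<inter> {..<j}" using j(2) by auto
    moreover have "\<kappa> * siz (Suc k) \<le> (\<kappa> + \<delta>) * siz k"
      using \<kappa>(2) \<delta> siz_ge_1[of k] mult_right_mono[of "\<kappa> * \<delta>" \<delta> "siz k"] mult_right_mono[of \<kappa> 1 \<delta>]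
      by (simp add: siz_def algebra_simps)
    ultimately have "\<kappa> * siz (Suc k) \<le> siz j - (\<Sum>i\<in>A \<inter> {..<j}. siz i)"
      using profit le \<delta>_siz by (simp add: algebra_simps)
    then show ?thesis using j unfolding siz_def by blast
  qed
  then show False
    using no_acceptance_pattern[of "1 + \<delta>" \<kappa> A] \<kappa> \<delta> by auto
qed

end

lemma competitive_ratio_le:
  assumes "online_scheduler S" "competitive \<alpha> S instances"
  shows "\<alpha> \<le> 3 - 2 * sqrt 2"
proof (rule ccontr)
  assume gt: "\<not> ?thesis"
  \<comment> \<open>Capping at 1 ensures \<open>\<kappa> \<le> 1\<close>. Then
    \<open>\<kappa>\<close> is the midpoint between the claimed bound and \<open>\<alpha>'\<close>,
    and the other half of the gap is \<open>2 * \<delta>\<close>.\<close>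
  define \<alpha>' where "\<alpha>' = min \<alpha> 1"
  define \<kappa> where "\<kappa> = (\<alpha>' + (3 - 2 * sqrt 2)) / 2"
  define \<delta> where "\<delta> = (\<alpha>' - \<kappa>) / 2"
  have "1 < sqrt (2::real)" by simp
  then have "3 - 2 * sqrt 2 < \<alpha>'" using gt by (simp add: \<alpha>'_def)
  moreover have "\<alpha>' \<le> 1" "\<alpha>' \<le> \<alpha>" by (simp_all add: \<alpha>'_def)
  moreover have "sqrt 2 \<le> 3 / 2" by (rule real_le_lsqrt) (simp_all add: power2_eq_square)
  ultimately have *: "0 < \<delta>" "\<delta> < 1 / 2" "3 - 2 * sqrt 2 < \<kappa>" "\<kappa> \<le> 1" "\<kappa> + 2 * \<delta> \<le> \<alpha>"
    by (auto simp: \<delta>_def \<kappa>_def field_simps)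
  interpret adversary \<delta> using * by unfold_locales
  show False using competitive_le[OF assms *(3-5)] .
qed

theorem theorem1:
  shows "(online_scheduler (dsc (1 + sqrt 2)) \<and>
          competitive (3 - 2 * sqrt 2) (dsc (1 + sqrt 2)) instances) \<and>
         (\<forall>S \<alpha>. online_scheduler S \<and> competitive \<alpha> S instances \<longrightarrow> \<alpha> \<le> 3 - 2 * sqrt 2)"
  using online_scheduler_dsc competitive_dsc competitive_ratio_le by blast

end
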